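(* Let $\nu$ be fixed with $\Re(\nu)>-1$, $a<b$, $f,g\in C^\infty[a,b]$ with $g'(x)\ne0$ on $[a,b]$, $g(\xi)=0$ for some $\xi\in[a,b]$ and $g(x)\ne0$ on $[a,b]\setminus\{\xi\}$. Let $\mathcal{H}_\nu[h]=\int_a^bh(x)J_\nu(\omega g(x))\,dx$ and define $\widetilde\sigma_k$ by $\widetilde\sigma_0[h]=h$, $\widetilde\sigma_k[h](x)=g(x)^{\nu+k}\frac{d}{dx}\left[\frac{\widetilde\sigma_{k-1}[h](x)-\widetilde\sigma_{k-1}[h](\xi)}{g(x)^{\nu+k}g'(x)}\right]$ ($k\ge1$, value at $\xi$ by continuous extension). Let $\varphi_k(x)=g'(x)g(x)^k$. Let $a=x_0<\dots<x_d=b$ be distinct nodes with $x_\ell=\xi$ for some $\ell\in\{0,\dots,d\}$, with positive integer multiplicities $m_0,\dots,m_d$, $n=\sum m_k$, and let $p=\sum_{k=0}^{n-1}c_k\varphi_k$ be the unique function in the span of $\varphi_0,\dots,\varphi_{n-1}$ with $p^{(j-1)}(x_k)=f^{(j-1)}(x_k)$ for $j=1,\dots,m_k$, $k=0,\dots,d$. Set $Q^F[f]=\mathcal{H}_\nu[p]$. If $m_0,m_\ell,m_d\ge m$ for an integer $m\ge1$, then as $\omega\to\infty$, $\mathcal{H}_\nu[f]-Q^F[f]=\mathcal{O}(\omega^{-m-1})$ if $\widetilde\sigma_m[f-p](\xi)\ne0$, and $=\mathcal{O}(\omega^{-m-3/2})$ if $\widetilde\sigma_m[f-p](\xi)=0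$.
   Context: $J_\nu$ is the Bessel function of the first kind of order $\nu$. The interpolant $p$ exists and is unique since the span of $\varphi_0,\dots,\varphi_{n-1}$ is an extended Chebyshev space. *)

theory Defs
  imports "HOL-Analysis.Analysis" "HOL-Library.Landau_Symbols"
begin

fun nderiv :: "real set \<Rightarrow> nat \<Rightarrow> (real \<Rightarrow> 'b::real_normed_vector) \<Rightarrow> real \<Rightarrow> 'b" where
  "nderiv S 0 f = f"
| "nderiv S (Suc k) f = (\<lambda>x. vector_derivative (nderiv S k f) (at x within S))"

definition C_infinity_on :: "real set \<Rightarrow> (real \<Rightarrow> 'b::real_normed_vector) \<Rightarrow> bool" where
  "C_infinity_on S f \<longleftrightarrow>
     (\<forall>k. \<forall>x\<in>S. (nderiv S k f has_vector_derivative nderiv S (Suc k) f x) (at x within S))"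

definition BesselJ :: "complex \<Rightarrow> complex \<Rightarrow> complex" where
  "BesselJ \<nu> z = (if \<nu> = 0 then 1 else (z / 2) powr \<nu>) *
     (\<Sum>k. (-1) ^ k * rGamma (\<nu> + of_nat k + 1) / of_nat (fact k) * (z / 2) ^ (2 * k))"

definition BesselH :: "complex \<Rightarrow> (real \<Rightarrow> real) \<Rightarrow> real \<Rightarrow> real \<Rightarrow> (real \<Rightarrow> real) \<Rightarrow> real \<Rightarrow> complex" where
  "BesselH \<nu> g a b h \<omega> =
     integral {a..b} (\<lambda>x. complex_of_real (h x) * BesselJ \<nu> (complex_of_real (\<omega> * g x)))"

fun sigma_t :: "complex \<Rightarrow> (real \<Rightarrow> real) \<Rightarrow> real \<Rightarrow> real set \<Rightarrow> (real \<Rightarrow> real) \<Rightarrow> nat \<Rightarrow> real \<Rightarrow> complex" where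
  "sigma_t \<nu> g \<xi> S h 0 = (\<lambda>x. complex_of_real (h x))"
| "sigma_t \<nu> g \<xi> S h (Suc k) =
     (let s = sigma_t \<nu> g \<xi> S h k;
          e = \<nu> + of_nat (Suc k);
          F = (\<lambda>y. complex_of_real (g y) powr e *
                 vector_derivative
                   (\<lambda>t. (s t - s \<xi>) / (complex_of_real (g t) powr e * complex_of_real (nderiv S 1 g t)))
                   (at y within S))
      in (\<lambda>x. if x = \<xi> then Lim (at \<xi> within S) F else F x))"

definition phi :: "(real \<Rightarrow> real) \<Rightarrow> real set \<Rightarrow> nat \<Rightarrow> real \<Rightarrow> real" where
  "phi g S k x = nderiv S 1 g x * g x ^ k"

end

theory Submission
  imports Defs
begin

text \<open>Write \<open>h = f - p\<close>. Since \<open>h\<close> vanishes to order \<open>m\<close> at \<open>a\<close>, \<open>\<xi>\<close> and \<open>b\<close>, one has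
  \<open>\<sigma>_k[h] = g' g^(m-k) K_k\<close> with \<open>K_k\<close> smooth, also at \<open>\<xi>\<close>. Because
  \<open>g^(\<mu>+1) J_(\<mu>+1)(\<omega> g)\<close> is a primitive of \<open>\<omega> g' g^(\<mu>+1) J_\<mu>(\<omega> g)\<close>, \<open>m\<close> integrations by parts, all without
  boundary terms, turn the error into \<open>(-1/\<omega>)^m\<close> times the integral of \<open>g' K_m J_(\<nu>+m)(\<omega> g)\<close>.
  One more integration by parts, now with boundary terms, and the decay \<open>J_\<mu>(t) = O(t^(-1/2))\<close> bound that integral by
  \<open>O(\<omega>^(-1))\<close>, and by \<open>O(\<omega>^(-3/2))\<close> if \<open>K_m\<close> vanishes at \<open>\<xi>\<close>.\<close>

subsection \<open>Smooth functions on a set\<close>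

text \<open>Two features of \<open>BesselJ\<close> shape the proof. For \<open>Re \<nu> < 0\<close>
  it is unbounded near 0, so the original integrand may be unbounded at \<open>\<xi>\<close>. Each
  integration by parts therefore differentiates a Bessel function of an order \<open>e\<close> with
  \<open>Re e > 0\<close>, continuous through \<open>\<xi>\<close>, and integrability comes out as a
  by-product. Moreover \<open>\<omega> * g\<close> can be negative, which puts the argument on the
  branch cut of \<open>powr\<close>; derivatives are therefore taken along the real line, and the
  factor of \<open>J\<close> beside the power is kept apart as an entire function. The last
  integration by parts produces \<open>K_m / g\<close>, which has a pole at \<open>\<xi>\<close>
  unless \<open>K_m\<close> vanishes there. With a pole, the Bessel factor confines the integrand to
  a zone of width about \<open>1/\<omega>\<close> around \<open>\<xi>\<close>, and the
  \<open>t^(-1/2)\<close> decay is spent on making it integrable. Without a pole, the decay passes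
  to every term and yields the extra half power.\<close>

primrec C_k_on :: "nat \<Rightarrow> real set \<Rightarrow> (real \<Rightarrow> 'a::{real_normed_field,banach}) \<Rightarrow> bool" where
  "C_k_on 0 S f \<longleftrightarrow> continuous_on S f"
| "C_k_on (Suc n) S f \<longleftrightarrow>
     (\<exists>f'. (\<forall>x\<in>S. (f has_vector_derivative f' x) (at x within S)) \<and> C_k_on n S f')"

text \<open>On a nondegenerate closed interval this agrees with \<open>C_infinity_on\<close>. Here
  the derivative at each level is an existential witness instead of a
  \<open>vector_derivative\<close>, so closure under sums, products and inverses is proved by
  exhibiting the derivative. \<open>vanishes_to\<close> is built the same way.\<close>

definition smooth_on :: "real set \<Rightarrow> (real \<Rightarrow> 'a::{real_normed_field,banach}) \<Rightarrow> bool" where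
  "smooth_on S f \<longleftrightarrow> (\<forall>n. C_k_on n S f)"

primrec vanishes_to :: "nat \<Rightarrow> real set \<Rightarrow> real \<Rightarrow> (real \<Rightarrow> 'a::real_normed_field) \<Rightarrow> bool" where
  "vanishes_to 0 S c f \<longleftrightarrow> True"
| "vanishes_to (Suc n) S c f \<longleftrightarrow> f c = 0 \<and>
     (\<exists>f'. (\<forall>x\<in>S. (f has_vector_derivative f' x) (at x within S)) \<and> vanishes_to n S c f')"

lemma C_k_on_SucD: "C_k_on (Suc n) S f \<Longrightarrow> C_k_on n S f"
proof (induction n arbitrary: f)
  case 0
  then show ?case
    by (auto simp: continuous_on_eq_continuous_within intro: has_vector_derivative_continuous)
next
  case (Suc n)
  then show ?case by (metis C_k_on.simps(2))
qed

lemma C_k_on_imp_continuous_on: "C_k_on n S f \<Longrightarrow> continuous_on S f"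
proof (induction n)
  case (Suc n)
  then show ?case using C_k_on_SucD by blast
qed simp

lemma C_k_on_cong:
  assumes "\<And>x. x \<in> S \<Longrightarrow> f x = g x"
  shows "C_k_on n S f \<longleftrightarrow> C_k_on n S g"
proof (cases n)
  case 0
  then show ?thesis using assms by (auto cong: continuous_on_cong)
next
  case (Suc k)
  have "(f has_vector_derivative d) (at x within S) \<longleftrightarrow> (g has_vector_derivative d) (at x within S)"
    if "x \<in> S" for x d
    using that assms by (metis has_vector_derivative_transform)
  with Suc show ?thesis by auto
qed

lemma C_k_on_add: "C_k_on n S f \<Longrightarrow> C_k_on n S g \<Longrightarrow> C_k_on n S (\<lambda>x. f x + g x)"
proof (induction n arbitrary: f g)
  case 0
  then show ?case by (simp add: continuous_on_add continuous_on_mult continuous_on_inverse)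
next
  case (Suc n)
  then obtain f' g' where "\<forall>x\<in>S. (f has_vector_derivative f' x) (at x within S)" "C_k_on n S f'"
    "\<forall>x\<in>S. (g has_vector_derivative g' x) (at x within S)" "C_k_on n S g'"
    by auto
  with Suc.IH[of f' g'] show ?case
    by (auto intro!: exI[of _ "\<lambda>x. f' x + g' x"] derivative_eq_intros)
qed

lemma C_k_on_mult: "C_k_on n S f \<Longrightarrow> C_k_on n S g \<Longrightarrow> C_k_on n S (\<lambda>x. f x * g x)"
proof (induction n arbitrary: f g)
  case 0
  then show ?case by (simp add: continuous_on_add continuous_on_mult continuous_on_inverse)
next
  case (Suc n)
  then obtain f' g' where f': "\<forall>x\<in>S. (f has_vector_derivative f' x) (at x within S)" "C_k_on n S f'"
    and g': "\<forall>x\<in>S. (g has_vector_derivative g' x) (at x within S)" "C_k_on n S g'"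
    by auto
  have "C_k_on n S (\<lambda>x. f x * g' x + f' x * g x)"
    by (rule C_k_on_add[OF Suc.IH[OF C_k_on_SucD[OF Suc.prems(1)] g'(2)]
          Suc.IH[OF f'(2) C_k_on_SucD[OF Suc.prems(2)]]])
  with f' g' show ?case
    by (auto intro!: exI[of _ "\<lambda>x. f x * g' x + f' x * g x"] derivative_eq_intros)
qed

lemma C_k_on_const: "C_k_on n S (\<lambda>_. c)"
proof (induction n arbitrary: c)
  case (Suc n)
  then show ?case by (auto intro!: exI[of _ "\<lambda>_. 0"])
qed auto

lemma C_k_on_of_real:
  fixes f :: "real \<Rightarrow> real"
  shows "C_k_on n S f \<Longrightarrow> C_k_on n S (\<lambda>x. of_real (f x))"
proof (induction n arbitrary: f)
  case (Suc n)
  then obtain f' where "\<forall>x\<in>S. (f has_vector_derivative f' x) (at x within S)" "C_k_on n S f'"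
    by auto
  with Suc.IH[of f'] show ?case
    by (auto intro!: exI[of _ "\<lambda>x. of_real (f' x)"] has_vector_derivative_of_real
             simp: has_real_derivative_iff_has_vector_derivative)
qed (simp add: continuous_on_of_real)

lemma has_vector_derivative_inverse_field:
  fixes f :: "real \<Rightarrow> 'a::real_normed_field"
  assumes "(f has_vector_derivative f') (at x within S)" "f x \<noteq> 0"
  shows "((\<lambda>x. inverse (f x)) has_vector_derivative - f' * (inverse (f x) * inverse (f x))) (at x within S)"
  using field_vector_diff_chain_within[OF assms(1) DERIV_inverse[OF assms(2)]]
  by (simp add: o_def power2_eq_square)

lemma C_k_on_inverse:
  "C_k_on n S f \<Longrightarrow> (\<And>x. x \<in> S \<Longrightarrow> f x \<noteq> 0) \<Longrightarrow> C_k_on n S (\<lambda>x. inverse (f x))"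
proof (induction n arbitrary: f)
  case 0
  then show ?case by (simp add: continuous_on_add continuous_on_mult continuous_on_inverse)
next
  case (Suc n)
  then obtain f' where f': "\<forall>x\<in>S. (f has_vector_derivative f' x) (at x within S)" "C_k_on n S f'"
    by auto
  have inv: "C_k_on n S (\<lambda>x. inverse (f x))"
    using Suc.IH[of f] Suc.prems C_k_on_SucD by blast
  have "C_k_on n S (\<lambda>x. (-1) * f' x * (inverse (f x) * inverse (f x)))"
    by (intro C_k_on_mult C_k_on_const inv f')
  with f' Suc.prems(2) show ?case
    by (auto intro!: exI[of _ "\<lambda>x. - f' x * (inverse (f x) * inverse (f x))"]
          has_vector_derivative_inverse_field)
qed

lemma smooth_on_add: "smooth_on S f \<Longrightarrow> smooth_on S g \<Longrightarrow> smooth_on S (\<lambda>x. f x + g x)"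
  by (simp add: smooth_on_def C_k_on_add)

lemma smooth_on_mult: "smooth_on S f \<Longrightarrow> smooth_on S g \<Longrightarrow> smooth_on S (\<lambda>x. f x * g x)"
  by (simp add: smooth_on_def C_k_on_mult)

lemma smooth_on_const: "smooth_on S (\<lambda>_. c)"
  by (simp add: smooth_on_def C_k_on_const)

lemma smooth_on_inverse:
  "smooth_on S f \<Longrightarrow> (\<And>x. x \<in> S \<Longrightarrow> f x \<noteq> 0) \<Longrightarrow> smooth_on S (\<lambda>x. inverse (f x))"
  by (simp add: smooth_on_def C_k_on_inverse)

lemma smooth_on_continuous: "smooth_on S f \<Longrightarrow> continuous_on S f"
  unfolding smooth_on_def by (metis C_k_on.simps(1))

lemma smooth_on_of_real: "smooth_on S f \<Longrightarrow> smooth_on S (\<lambda>x. of_real (f x))"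
  for f :: "real \<Rightarrow> real"
  by (simp add: smooth_on_def C_k_on_of_real)

lemma smooth_on_minus: "smooth_on S f \<Longrightarrow> smooth_on S (\<lambda>x. - f x)"
  using smooth_on_mult[OF smooth_on_const[where c = "-1"], of S f] by simp

lemma smooth_on_diff: "smooth_on S f \<Longrightarrow> smooth_on S g \<Longrightarrow> smooth_on S (\<lambda>x. f x - g x)"
  using smooth_on_add[OF _ smooth_on_minus[of S g], of f] by simp

lemma smooth_on_divide:
  "smooth_on S f \<Longrightarrow> smooth_on S g \<Longrightarrow> (\<And>x. x \<in> S \<Longrightarrow> g x \<noteq> 0) \<Longrightarrow> smooth_on S (\<lambda>x. f x / g x)"
  unfolding divide_inverse by (intro smooth_on_mult smooth_on_inverse)

lemma smooth_on_power: "smooth_on S f \<Longrightarrow> smooth_on S (\<lambda>x. f x ^ n)"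
proof (induction n)
  case 0
  then show ?case using smooth_on_const[where c = 1] by simp
next
  case (Suc n)
  then show ?case by (simp add: smooth_on_mult)
qed

lemma smooth_on_sum:
  "(\<And>i. i \<in> I \<Longrightarrow> smooth_on S (f i)) \<Longrightarrow> smooth_on S (\<lambda>x. \<Sum>i\<in>I. f i x)"
proof (induction I rule: infinite_finite_induct)
  case (insert i I)
  then show ?case by (simp add: smooth_on_add)
qed (simp_all add: smooth_on_const)

text \<open>Makes the witnesses in \<open>C_k_on\<close> and \<open>vanishes_to\<close>
  interchangeable, also at the endpoints, where the derivative is one-sided.\<close>

lemma has_vector_derivative_Icc_unique:
  assumes "a < b" "x \<in> {a..b}" "(f has_vector_derivative d) (at x within {a..b})"
    "(f has_vector_derivative d') (at x within {a..b})"
  shows "d = d'"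
  using assms vector_derivative_unique_within_closed_interval[of a b x f d d'] by simp

text \<open>The level \<open>n\<close> may come with a witness of its own; uniqueness identifies all
  of them with \<open>f'\<close>.\<close>

lemma smooth_on_deriv:
  assumes "a < b" "smooth_on {a..b} f" "\<And>x. x \<in> {a..b} \<Longrightarrow> (f has_vector_derivative f' x) (at x within {a..b})"
  shows "smooth_on {a..b} f'"
  unfolding smooth_on_def
proof
  fix n
  obtain d where d: "\<forall>x\<in>{a..b}. (f has_vector_derivative d x) (at x within {a..b})" "C_k_on n {a..b} d"
    using assms(2) by (metis smooth_on_def C_k_on.simps(2))
  have "d x = f' x" if "x \<in> {a..b}" for x
    using has_vector_derivative_Icc_unique[OF assms(1) that] d(1) assms(3) that by blast
  with d(2) show "C_k_on n {a..b} f'" using C_k_on_cong by blast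
qed

lemma smooth_on_obtain_deriv:
  assumes "a < b" "smooth_on {a..b} f"
  obtains f' where "\<And>x. x \<in> {a..b} \<Longrightarrow> (f has_vector_derivative f' x) (at x within {a..b})"
    "smooth_on {a..b} f'"
  using assms smooth_on_deriv[OF assms] by (metis smooth_on_def C_k_on.simps(2))

lemma smooth_on_imp_C_infinity_on:
  assumes "a < b" "smooth_on {a..b} f"
  shows "C_infinity_on {a..b} f"
proof -
  have vd: "(h has_vector_derivative vector_derivative h (at x within {a..b})) (at x within {a..b})"
    if "smooth_on {a..b} h" "x \<in> {a..b}" for h :: "real \<Rightarrow> 'a" and x
    using smooth_on_obtain_deriv[OF assms(1) that(1)] that(2)
    by (metis box_real(2) vector_derivative_within_cbox assms(1))
  have "smooth_on {a..b} (nderiv {a..b} k f)" for k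
  proof (induction k)
    case (Suc k)
    then show ?case using smooth_on_deriv[OF assms(1) Suc vd[OF Suc]] by simp
  qed (simp add: assms)
  then show ?thesis unfolding C_infinity_on_def using vd by simp
qed

lemma C_infinity_on_imp_smooth_on:
  assumes "C_infinity_on S f"
  shows "smooth_on S (nderiv S k f)"
proof -
  have "C_k_on n S (nderiv S k f)" for n
  proof (induction n arbitrary: k)
    case 0
    then show ?case using assms
      by (auto simp: C_infinity_on_def continuous_on_eq_continuous_within
               intro!: has_vector_derivative_continuous)
  next
    case (Suc n)
    then show ?case using assms unfolding C_infinity_on_def C_k_on.simps by blast
  qed
  then show ?thesis by (simp add: smooth_on_def)
qed

subsection \<open>Order of vanishing\<close>

lemma vanishes_to_SucD: "vanishes_to (Suc n) S c f \<Longrightarrow> vanishes_to n S c f"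
proof (induction n arbitrary: f)
  case (Suc n)
  then show ?case by (metis vanishes_to.simps(2))
qed simp

lemma vanishes_to_cong:
  assumes "\<And>x. x \<in> S \<Longrightarrow> f x = g x" "c \<in> S"
  shows "vanishes_to n S c f \<longleftrightarrow> vanishes_to n S c g"
proof (cases n)
  case (Suc k)
  have "(f has_vector_derivative d) (at x within S) \<longleftrightarrow> (g has_vector_derivative d) (at x within S)"
    if "x \<in> S" for x d
    using that assms by (metis has_vector_derivative_transform)
  with Suc assms show ?thesis by auto
qed auto

lemma vanishes_to_add:
  "vanishes_to n S c f \<Longrightarrow> vanishes_to n S c g \<Longrightarrow> vanishes_to n S c (\<lambda>x. f x + g x)"
proof (induction n arbitrary: f g)
  case (Suc n)
  then obtain f' g' where "\<forall>x\<in>S. (f has_vector_derivative f' x) (at x within S)" "vanishes_to n S c f'"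
    "\<forall>x\<in>S. (g has_vector_derivative g' x) (at x within S)" "vanishes_to n S c g'"
    by auto
  with Suc.IH[of f' g'] Suc.prems show ?case
    by (auto intro!: exI[of _ "\<lambda>x. f' x + g' x"] derivative_eq_intros)
qed simp

lemma vanishes_to_mult_right:
  "vanishes_to n S c f \<Longrightarrow> C_k_on n S g \<Longrightarrow> vanishes_to n S c (\<lambda>x. f x * g x)"
proof (induction n arbitrary: f g)
  case (Suc n)
  then obtain f' g' where f': "\<forall>x\<in>S. (f has_vector_derivative f' x) (at x within S)" "vanishes_to n S c f'"
    and g': "\<forall>x\<in>S. (g has_vector_derivative g' x) (at x within S)" "C_k_on n S g'"
    by auto
  have "vanishes_to n S c (\<lambda>x. f x * g' x + f' x * g x)"
    by (rule vanishes_to_add[OF Suc.IH[OF vanishes_to_SucD[OF Suc.prems(1)] g'(2)]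
          Suc.IH[OF f'(2) C_k_on_SucD[OF Suc.prems(2)]]])
  with f' g' Suc.prems show ?case
    by (auto intro!: exI[of _ "\<lambda>x. f x * g' x + f' x * g x"] derivative_eq_intros)
qed simp

lemma vanishes_to_mult_left:
  "C_k_on n S f \<Longrightarrow> vanishes_to n S c g \<Longrightarrow> vanishes_to n S c (\<lambda>x. f x * g x)"
  using vanishes_to_mult_right[of n S c g f] by (simp add: mult.commute)

lemma vanishes_to_deriv:
  assumes "a < b" "c \<in> {a..b}" "vanishes_to (Suc n) {a..b} c f"
    "\<And>x. x \<in> {a..b} \<Longrightarrow> (f has_vector_derivative f' x) (at x within {a..b})"
  shows "vanishes_to n {a..b} c f'"
proof -
  obtain d where d: "\<forall>x\<in>{a..b}. (f has_vector_derivative d x) (at x within {a..b})" "vanishes_to n {a..b} c d"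
    using assms(3) by auto
  have "d x = f' x" if "x \<in> {a..b}" for x
    using has_vector_derivative_Icc_unique[OF assms(1) that] d(1) assms(4) that by blast
  with d(2) show ?thesis using vanishes_to_cong assms(2) by blast
qed

text \<open>The product rule solved for \<open>f' * g = (f * g)' - f * g'\<close>: the induction
  hypothesis for \<open>f\<close> lets \<open>f * g'\<close> vanish to order \<open>n\<close>, and
  the one for \<open>f'\<close> then cancels \<open>g\<close>. Working at the point \<open>c\<close>
  instead of dividing by \<open>g\<close> matters because the lemma is applied to a factor
  \<open>g\<close> that has a zero elsewhere in the interval, namely at
  \<open>\<xi>\<close>.\<close>

lemma vanishes_to_cancel_right:
  assumes "a < b" "c \<in> {a..b}"
  shows "C_k_on n {a..b} f \<Longrightarrow> C_k_on n {a..b} g \<Longrightarrow> g c \<noteq> 0 \<Longrightarrow>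
    vanishes_to n {a..b} c (\<lambda>x. f x * g x) \<Longrightarrow> vanishes_to n {a..b} c f"
proof (induction n arbitrary: f)
  case (Suc n)
  let ?S = "{a..b}"
  obtain f' g' where f': "\<forall>x\<in>?S. (f has_vector_derivative f' x) (at x within ?S)" "C_k_on n ?S f'"
    and g': "\<forall>x\<in>?S. (g has_vector_derivative g' x) (at x within ?S)" "C_k_on n ?S g'"
    using Suc.prems by auto
  have "vanishes_to n ?S c f"
    using Suc.IH[of f] Suc.prems C_k_on_SucD vanishes_to_SucD by blast
  then have 1: "vanishes_to n ?S c (\<lambda>x. (-1) * (f x * g' x))"
    by (intro vanishes_to_mult_left C_k_on_const vanishes_to_mult_right g')
  have "vanishes_to n ?S c (\<lambda>x. f x * g' x + f' x * g x)"
    by (rule vanishes_to_deriv[OF assms Suc.prems(4)])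
       (use f'(1) g'(1) in \<open>auto intro!: derivative_eq_intros\<close>)
  from vanishes_to_add[OF this 1] have "vanishes_to n ?S c (\<lambda>x. f' x * g x)"
    by (simp add: algebra_simps)
  then have "vanishes_to n ?S c f'"
    using Suc.IH[of f'] Suc.prems f' C_k_on_SucD by blast
  then show ?case using f'(1) Suc.prems by auto
qed simp

text \<open>The shift \<open>i\<close> serves the induction, which passes from both functions to
  their derivatives. The interpolation conditions enter with \<open>i = 0\<close>.\<close>

lemma vanishes_to_diff_of_nderiv_eq:
  fixes f p :: "real \<Rightarrow> real"
  assumes "C_infinity_on S f" "C_infinity_on S p"
    and "\<And>j. j < n \<Longrightarrow> nderiv S (i + j) f c = nderiv S (i + j) p c"
  shows "vanishes_to n S c (\<lambda>x. of_real (nderiv S i f x - nderiv S i p x) :: 'a::real_normed_field)"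
  using assms(3)
proof (induction n arbitrary: i)
  case (Suc n)
  have "vanishes_to n S c (\<lambda>x. of_real (nderiv S (Suc i) f x - nderiv S (Suc i) p x) :: 'a)"
    using Suc.IH[of "Suc i"] Suc.prems[of "Suc _"] by simp
  moreover have "((\<lambda>x. of_real (nderiv S i f x - nderiv S i p x) :: 'a) has_vector_derivative
      of_real (nderiv S (Suc i) f x - nderiv S (Suc i) p x)) (at x within S)" if "x \<in> S" for x
    using assms(1,2) that unfolding C_infinity_on_def
    by (intro has_vector_derivative_of_real)
       (auto simp del: nderiv.simps simp: has_real_derivative_iff_has_vector_derivative intro!: derivative_intros)
  moreover have "nderiv S i f c - nderiv S i p c = 0"
    using Suc.prems[of 0] by simp
  ultimately show ?case
    unfolding vanishes_to.simps of_real_eq_0_iff by (intro conjI exI ballI)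
qed simp

subsection \<open>Division by a power of the distance to a zero\<close>

text \<open>The averages that occur as quotients in Hadamard's lemma. Differentiation under the
  integral sign brings out a factor \<open>s\<close>, so the weight \<open>s ^ j\<close> gains one
  power per derivative and the induction must run over all \<open>j\<close>.\<close>

lemma C_k_on_average:
  fixes \<phi> :: "real \<Rightarrow> 'a::{real_normed_field,banach}"
  assumes "\<xi> \<in> {a..b}"
  shows "C_k_on n {a..b} \<phi> \<Longrightarrow>
    C_k_on n {a..b} (\<lambda>x. integral {0..1} (\<lambda>s. s ^ j *\<^sub>R \<phi> (\<xi> + s * (x - \<xi>))))"
proof (induction n arbitrary: \<phi> j)
  case 0
  have in_S: "\<xi> + s * (x - \<xi>) \<in> {a..b}" if "x \<in> {a..b}" "s \<in> {0..1}" for x s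
    using convexD_alt[of "{a..b}" \<xi> x s] that assms by (auto simp: algebra_simps)
  have "continuous_on ({a..b} \<times> {0..1}) (\<lambda>(x, s). s ^ j *\<^sub>R \<phi> (\<xi> + s * (x - \<xi>)))"
    unfolding case_prod_beta
    by (intro continuous_intros continuous_on_compose2[where f = "\<lambda>u. \<xi> + snd u * (fst u - \<xi>)" and g = \<phi> and t = "{a..b}"])
       (use 0 in_S in auto)
  then have "continuous_on {a..b} (\<lambda>x. integral (cbox 0 1) (\<lambda>s. s ^ j *\<^sub>R \<phi> (\<xi> + s * (x - \<xi>))))"
    by (intro integral_continuous_on_param) simp
  then show ?case by simp
next
  case (Suc n)
  have in_S: "\<xi> + s * (x - \<xi>) \<in> {a..b}" if "x \<in> {a..b}" "s \<in> {0..1}" for x s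
    using convexD_alt[of "{a..b}" \<xi> x s] that assms by (auto simp: algebra_simps)
  obtain \<phi>' where d: "\<forall>x\<in>{a..b}. (\<phi> has_vector_derivative \<phi>' x) (at x within {a..b})" and C: "C_k_on n {a..b} \<phi>'"
    using Suc.prems by auto
  have cont: "continuous_on {a..b} \<phi>" "continuous_on {a..b} \<phi>'"
    using Suc.prems C C_k_on_imp_continuous_on by blast+
  have 1: "((\<lambda>x. s ^ j *\<^sub>R \<phi> (\<xi> + s * (x - \<xi>))) has_vector_derivative s ^ Suc j *\<^sub>R \<phi>' (\<xi> + s * (x - \<xi>)))
      (at x within {a..b})" if x: "x \<in> {a..b}" and s: "s \<in> {0..1}" for x s
  proof -
    have "((\<lambda>x. \<xi> + s * (x - \<xi>)) has_vector_derivative s) (at x within {a..b})"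
      by (auto intro!: derivative_eq_intros simp flip: has_real_derivative_iff_has_vector_derivative)
    moreover have "(\<phi> has_vector_derivative \<phi>' (\<xi> + s * (x - \<xi>)))
        (at (\<xi> + s * (x - \<xi>)) within (\<lambda>x. \<xi> + s * (x - \<xi>)) ` {a..b})"
      using d in_S[OF x s] by (rule_tac has_vector_derivative_within_subset) (use in_S s in auto)
    ultimately have "((\<phi> \<circ> (\<lambda>x. \<xi> + s * (x - \<xi>))) has_vector_derivative s *\<^sub>R \<phi>' (\<xi> + s * (x - \<xi>))) (at x within {a..b})"
      by (rule vector_diff_chain_within)
    then show ?thesis by (auto simp: o_def intro!: derivative_eq_intros)
  qed
  have 2: "continuous_on ({a..b} \<times> {0..1}) (\<lambda>(x, s). s ^ Suc j *\<^sub>R \<phi>' (\<xi> + s * (x - \<xi>)))"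
    unfolding case_prod_beta
    by (intro continuous_intros continuous_on_compose2[where f = "\<lambda>u. \<xi> + snd u * (fst u - \<xi>)" and g = \<phi>' and t = "{a..b}"])
       (use cont in_S in auto)
  have 3: "(\<lambda>s. s ^ j *\<^sub>R \<phi> (\<xi> + s * (x - \<xi>))) integrable_on {0..1}" if "x \<in> {a..b}" for x
    by (intro integrable_continuous_real continuous_intros continuous_on_compose2[where f = "\<lambda>s. \<xi> + s * (x - \<xi>)" and g = \<phi> and t = "{a..b}"])
       (use cont in_S that in auto)
  have "((\<lambda>x. integral {0..1} (\<lambda>s. s ^ j *\<^sub>R \<phi> (\<xi> + s * (x - \<xi>)))) has_vector_derivative
      integral {0..1} (\<lambda>s. s ^ Suc j *\<^sub>R \<phi>' (\<xi> + s * (x - \<xi>)))) (at x within {a..b})"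
    if "x \<in> {a..b}" for x
    by (rule leibniz_rule_vector_derivative[where U = "{a..b}" and a = 0 and b = "1::real", simplified cbox_interval])
       (use 1 2 3 that in auto)
  then show ?case
    unfolding C_k_on.simps using Suc.IH[OF C, of "Suc j"] by (intro exI conjI ballI)
qed

text \<open>Hadamard's lemma, iterated. Integrating \<open>h'\<close> along the segment from
  \<open>\<xi>\<close> to \<open>x\<close> gives one factor \<open>x - \<xi>\<close>; the induction
  hypothesis for \<open>h'\<close> gives the others and leaves the weight \<open>s ^ m\<close> under
  the integral. The quotient is thus an average, smooth at \<open>\<xi>\<close> without any limit
  argument.\<close>

lemma vanishes_to_factor:
  fixes h :: "real \<Rightarrow> 'a::{real_normed_field,banach}"
  assumes "a < b" "\<xi> \<in> {a..b}"
  shows "smooth_on {a..b} h \<Longrightarrow> vanishes_to m {a..b} \<xi> h \<Longrightarrow>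
    \<exists>K. smooth_on {a..b} K \<and> (\<forall>x\<in>{a..b}. h x = of_real (x - \<xi>) ^ m * K x)"
proof (induction m arbitrary: h)
  case (Suc m)
  obtain h' where h': "\<And>x. x \<in> {a..b} \<Longrightarrow> (h has_vector_derivative h' x) (at x within {a..b})" "smooth_on {a..b} h'"
    using smooth_on_obtain_deriv[OF assms(1) Suc.prems(1)] by blast
  have "vanishes_to m {a..b} \<xi> h'"
    using vanishes_to_deriv[OF assms Suc.prems(2) h'(1)] .
  from Suc.IH[OF h'(2) this] obtain K where K: "smooth_on {a..b} K"
    "\<forall>x\<in>{a..b}. h' x = of_real (x - \<xi>) ^ m * K x" by blast
  define L where "L = (\<lambda>x. integral {0..1} (\<lambda>s. s ^ m *\<^sub>R K (\<xi> + s * (x - \<xi>))))"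
  have in_S: "\<xi> + s * (x - \<xi>) \<in> {a..b}" if "x \<in> {a..b}" "s \<in> {0..1}" for x s
    using convexD_alt[of "{a..b}" \<xi> x s] that assms by (auto simp: algebra_simps)
  have "h x = of_real (x - \<xi>) ^ Suc m * L x" if x: "x \<in> {a..b}" for x
  proof -
    have "((\<lambda>s. h (\<xi> + s * (x - \<xi>))) has_vector_derivative (x - \<xi>) *\<^sub>R h' (\<xi> + s * (x - \<xi>))) (at s within {0..1})"
      if s: "s \<in> {0..1}" for s
    proof -
      have "((\<lambda>s. \<xi> + s * (x - \<xi>)) has_vector_derivative (x - \<xi>)) (at s within {0..1})"
        by (auto intro!: derivative_eq_intros simp flip: has_real_derivative_iff_has_vector_derivative)
      moreover have "(h has_vector_derivative h' (\<xi> + s * (x - \<xi>)))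
          (at (\<xi> + s * (x - \<xi>)) within (\<lambda>s. \<xi> + s * (x - \<xi>)) ` {0..1})"
        using h'(1) in_S[OF x s] by (rule_tac has_vector_derivative_within_subset) (use in_S x in auto)
      ultimately show ?thesis
        using vector_diff_chain_within by (fastforce simp: o_def)
    qed
    then have "((\<lambda>s. (x - \<xi>) *\<^sub>R h' (\<xi> + s * (x - \<xi>))) has_integral
        h (\<xi> + 1 * (x - \<xi>)) - h (\<xi> + 0 * (x - \<xi>))) {0..1}"
      by (intro fundamental_theorem_of_calculus) auto
    then have "((\<lambda>s. (x - \<xi>) *\<^sub>R h' (\<xi> + s * (x - \<xi>))) has_integral h x) {0..1}"
      using Suc.prems(2) by simp
    then have "h x = integral {0..1} (\<lambda>s. (x - \<xi>) *\<^sub>R h' (\<xi> + s * (x - \<xi>)))"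
      by (rule integral_unique[symmetric])
    also have "\<dots> = integral {0..1} (\<lambda>s. of_real (x - \<xi>) ^ Suc m * (s ^ m *\<^sub>R K (\<xi> + s * (x - \<xi>))))"
      using K(2) in_S[OF x]
      by (intro integral_cong) (simp add: scaleR_conv_of_real power_mult_distrib)
    also have "\<dots> = of_real (x - \<xi>) ^ Suc m * L x"
      unfolding L_def by (rule integral_mult_right)
    finally show ?thesis .
  qed
  moreover have "smooth_on {a..b} L"
    using K(1) C_k_on_average[OF assms(2)] unfolding smooth_on_def L_def by blast
  ultimately show ?case by blast
qed auto

subsection \<open>Bessel functions on the real line\<close>

text \<open>The Bessel-Clifford function at \<open>- w\<close>, so that \<open>J\<close> of order
  \<open>\<mu>\<close> at \<open>z\<close> is \<open>(z/2) powr \<mu>\<close> times this function at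
  \<open>(z/2)^2\<close>. It is entire and even in \<open>z\<close>; the branch cut sits in the
  power alone. With \<open>rGamma\<close>, negative integer orders are no exception.\<close>

definition bessel_entire :: "complex \<Rightarrow> complex \<Rightarrow> complex" where
  "bessel_entire \<mu> w = (\<Sum>k. (-1) ^ k * rGamma (\<mu> + of_nat k + 1) / of_nat (fact k) * w ^ k)"

lemma summable_bessel_entire:
  "summable (\<lambda>k. (-1) ^ k * rGamma (\<mu> + of_nat k + 1) / of_nat (fact k) * w ^ k :: complex)"
proof -
  \<comment> \<open>For \<open>k \<ge> N\<close> the part \<open>norm (\<mu> + 1) + 1\<close> forces
    \<open>norm (\<mu> + of_nat k + 1) \<ge> 1\<close>, so \<open>rGamma\<close> does not grow from
    one term to the next, and \<open>2 * norm w\<close> makes the ratio at most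
    \<open>1/2\<close>.\<close>
  obtain N :: nat where N: "2 * norm w + norm (\<mu> + 1) + 1 \<le> real N"
    using real_arch_simple by blast
  let ?f = "\<lambda>k. (-1) ^ k * rGamma (\<mu> + of_nat k + 1) / of_nat (fact k) * w ^ k :: complex"
  have "norm (?f (Suc k)) \<le> 1/2 * norm (?f k)" if "k \<ge> N" for k
  proof -
    have "real k \<le> norm (\<mu> + of_nat k + 1) + norm (\<mu> + 1)"
      using norm_triangle_ineq4[of "\<mu> + of_nat k + 1" "\<mu> + 1"] by simp
    then have 1: "1 \<le> norm (\<mu> + of_nat k + 1)" and 2: "2 * norm w \<le> real (Suc k)"
      using N that norm_ge_zero[of w] norm_ge_zero[of "\<mu> + 1"] by linarith+
    have "rGamma (\<mu> + of_nat k + 1) = (\<mu> + of_nat k + 1) * rGamma (\<mu> + of_nat (Suc k) + 1)"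
      using rGamma_plus1[of "\<mu> + of_nat k + 1"] by (simp add: algebra_simps)
    then have "norm (rGamma (\<mu> + of_nat k + 1)) \<ge> norm (rGamma (\<mu> + of_nat (Suc k) + 1))"
      using mult_right_mono[OF 1, of "norm (rGamma (\<mu> + of_nat (Suc k) + 1))"] by (simp add: norm_mult)
    then have "norm (rGamma (\<mu> + of_nat (Suc k) + 1)) * (2 * norm w) \<le> norm (rGamma (\<mu> + of_nat k + 1)) * real (Suc k)"
      using 2 by (intro mult_mono) auto
    then have "norm (rGamma (\<mu> + of_nat (Suc k) + 1)) * norm w / real (Suc k) \<le> 1/2 * norm (rGamma (\<mu> + of_nat k + 1))"
      by (simp add: field_simps del: of_nat_Suc)
    then have "norm (rGamma (\<mu> + of_nat (Suc k) + 1)) * norm w / real (Suc k) * (norm w ^ k / fact k)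
        \<le> 1/2 * norm (rGamma (\<mu> + of_nat k + 1)) * (norm w ^ k / fact k)"
      by (rule mult_right_mono) simp
    moreover have n: "norm (?f j) = norm (rGamma (\<mu> + of_nat j + 1)) * norm w ^ j / fact j" for j
      by (simp add: norm_mult norm_divide norm_power)
    ultimately show ?thesis
      unfolding n unfolding fact_Suc power_Suc by (simp add: field_simps del: of_nat_Suc)
  qed
  then show ?thesis
    by (intro summable_ratio_test[of "1/2" N]) auto
qed

lemma DERIV_bessel_entire:
  "(bessel_entire \<mu> has_field_derivative - bessel_entire (\<mu> + 1) w) (at w)"
proof -
  let ?c = "\<lambda>k. (-1) ^ k * rGamma (\<mu> + of_nat k + 1) / of_nat (fact k) :: complex"
  have "((\<lambda>w. \<Sum>n. ?c n * w ^ n) has_field_derivative (\<Sum>n. diffs ?c n * w ^ n)) (at w)"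
    by (rule termdiffs_strong_converges_everywhere) (rule summable_bessel_entire)
  moreover have "diffs ?c n * w ^ n =
      - ((-1) ^ n * rGamma (\<mu> + 1 + of_nat n + 1) / of_nat (fact n) * w ^ n)" for n
  proof -
    have "of_nat (Suc n) \<noteq> (0::complex)" by (rule of_nat_neq_0)
    then show ?thesis
      by (simp add: diffs_def field_simps del: of_nat_Suc) (simp add: algebra_simps)
  qed
  ultimately show ?thesis
    unfolding bessel_entire_def using suminf_minus[OF summable_bessel_entire[of "\<mu> + 1" w]] by simp
qed

text \<open>Comparison of coefficients. In \<open>rGamma z = z * rGamma (z + 1)\<close> with
  \<open>z = \<mu> + k + 1\<close>, the part \<open>\<mu> + 1\<close> of the factor gives the series
  of order \<open>\<mu> + 1\<close>, while the part \<open>k\<close> cancels against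
  \<open>fact k\<close> and leaves the series of order \<open>\<mu> + 2\<close>, shifted by one
  power of \<open>w\<close>. The sequence \<open>b\<close> is that shifted series.\<close>

lemma bessel_entire_recurrence:
  "bessel_entire \<mu> w = (\<mu> + 1) * bessel_entire (\<mu> + 1) w - w * bessel_entire (\<mu> + 2) w"
proof -
  let ?a = "\<lambda>\<mu> k. (-1) ^ k * rGamma (\<mu> + of_nat k + 1) / of_nat (fact k) * w ^ k :: complex"
  have sums: "?a \<mu> sums bessel_entire \<mu> w" for \<mu>
    unfolding bessel_entire_def by (rule summable_sums[OF summable_bessel_entire])
  define b where "b = (\<lambda>k. case k of 0 \<Rightarrow> 0 | Suc j \<Rightarrow> w * ?a (\<mu> + 2) j)"
  have "(\<lambda>j. b (Suc j)) sums (w * bessel_entire (\<mu> + 2) w)"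
    unfolding b_def nat.case by (rule sums_mult[OF sums])
  then have "b sums (w * bessel_entire (\<mu> + 2) w)"
    by (subst (asm) sums_Suc_iff) (simp add: b_def)
  then have "(\<lambda>k. (\<mu> + 1) * ?a (\<mu> + 1) k - b k) sums
      ((\<mu> + 1) * bessel_entire (\<mu> + 1) w - w * bessel_entire (\<mu> + 2) w)"
    by (intro sums_diff sums_mult sums)
  moreover have "(\<mu> + 1) * ?a (\<mu> + 1) k - b k = ?a \<mu> k" for k
  proof -
    have r: "rGamma (\<mu> + of_nat k + 1) = (\<mu> + of_nat k + 1) * rGamma (\<mu> + 1 + of_nat k + 1)"
      using rGamma_plus1[of "\<mu> + of_nat k + 1"] by (simp add: algebra_simps)
    show ?thesis
    proof (cases k)
      case 0
      then show ?thesis using r by (simp add: b_def)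
    next
      case (Suc j)
      have "rGamma (\<mu> + 2 + of_nat j + 1) = rGamma (\<mu> + 1 + of_nat k + 1)"
        using Suc by (simp add: add_ac)
      then have "b k = w * ((-1) ^ j * rGamma (\<mu> + 1 + of_nat k + 1) / of_nat (fact j) * w ^ j)"
        by (simp only: b_def Suc nat.case)
      moreover have "complex_of_nat (fact k) = of_nat k * of_nat (fact j)"
        using Suc by (simp add: algebra_simps)
      moreover have "w * ((-1) ^ j * R / F * w ^ j) = - K * ((-1) ^ Suc j * R / (K * F) * w ^ Suc j)"
        if "K \<noteq> 0" "F \<noteq> 0" for R F K :: complex
        using that by (simp add: field_simps)
      moreover have "complex_of_nat k \<noteq> 0" "complex_of_nat (fact j) \<noteq> 0"
        using Suc by (simp_all del: of_nat_Suc)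
      ultimately have "b k = - of_nat k * ?a (\<mu> + 1) k"
        by (simp only: Suc)
      then show ?thesis unfolding r by (simp add: field_simps)
    qed
  qed
  ultimately show ?thesis using sums[of \<mu>] sums_unique2 by fastforce
qed

section \<open>Bessel functions at real arguments of either sign: recurrence, derivative,
  size\<close>

lemma BesselJ_of_real:
  "t \<noteq> 0 \<Longrightarrow> BesselJ \<mu> (of_real t) = of_real (t / 2) powr \<mu> * bessel_entire \<mu> (of_real ((t / 2)\<^sup>2))"
  unfolding BesselJ_def bessel_entire_def by (simp add: power_mult)

text \<open>Rests on the convention \<open>0 powr \<mu> = 0\<close>. For \<open>Re \<mu> > 0\<close>
  this is the limit at 0; for other orders it is in general only a default value.\<close>

lemma BesselJ_zero: "\<mu> \<noteq> 0 \<Longrightarrow> BesselJ \<mu> 0 = 0"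
  by (simp add: BesselJ_def)

text \<open>Holds for negative \<open>t\<close> as well: the orders differ by integers, so the
  principal power \<open>T powr \<mu>\<close> is a common factor on either side of the branch
  cut.\<close>

lemma BesselJ_recurrence:
  assumes "t \<noteq> 0"
  shows "2 * (\<mu> + 1) / of_real t * BesselJ (\<mu> + 1) (of_real t) =
    BesselJ \<mu> (of_real t) + BesselJ (\<mu> + 2) (of_real t)"
proof -
  define T where "T = complex_of_real (t / 2)"
  define \<Phi> where "\<Phi> = (\<lambda>\<mu>. bessel_entire \<mu> (of_real ((t / 2)\<^sup>2)))"
  have T: "T \<noteq> 0" "of_real t = 2 * T" using assms by (simp_all add: T_def)
  have P1: "T powr (\<mu> + 1) = T powr \<mu> * T"
    using T by (simp add: powr_add)
  have "\<mu> + 2 = \<mu> + 1 + 1" by simp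
  then have P2: "T powr (\<mu> + 2) = T powr \<mu> * T * T"
    using T by (simp only: powr_add) simp
  have J: "BesselJ \<mu> (of_real t) = T powr \<mu> * \<Phi> \<mu>" for \<mu>
    using BesselJ_of_real[OF assms] by (simp only: T_def \<Phi>_def)
  have rec: "\<Phi> \<mu> = (\<mu> + 1) * \<Phi> (\<mu> + 1) - T * T * \<Phi> (\<mu> + 2)"
    using bessel_entire_recurrence[of \<mu> "of_real ((t / 2)\<^sup>2)"]
    by (simp add: \<Phi>_def T_def power2_eq_square)
  show ?thesis
    unfolding J P1 P2 unfolding T(2) rec using T(1) by (simp add: field_simps)
qed

text \<open>Negative \<open>t\<close> lie on the branch cut, where the complex derivative may fail
  to exist. Along the real line the logarithm is \<open>ln \<bar>t\<bar>\<close> plus a constant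
  \<open>c\<close> on each half-axis, and that is differentiable.\<close>

lemma has_vector_derivative_powr_of_real:
  assumes "t \<noteq> 0"
  shows "((\<lambda>t. complex_of_real t powr e) has_vector_derivative e / of_real t * of_real t powr e) (at t)"
proof -
  define c where "c = (if t < 0 then \<i> * of_real pi else 0)"
  define U where "U = (if t < 0 then {..<0::real} else {0<..})"
  have eq: "exp (e * (of_real (ln \<bar>s\<bar>) + c)) = complex_of_real s powr e" if "s \<in> U" for s
    using that unfolding U_def c_def powr_def
    by (auto split: if_splits simp: Ln_of_real' mult.commute)
  \<comment> \<open>The real \<open>ln\<close> is an even function by convention, so the derivative
    on the negative axis is obtained by reflection.\<close>
  have ln_abs: "ln \<bar>s\<bar> = ln s" for s :: real
    by (simp add: abs_if ln_minus)
  have "((\<lambda>s. ln \<bar>s\<bar>) has_real_derivative 1 / t) (at t)"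
  proof (cases "t > 0")
    case True
    then show ?thesis unfolding ln_abs by (rule DERIV_ln_divide)
  next
    case False
    then show ?thesis
      using DERIV_ln_divide[of "- t"] DERIV_mirror[of ln "1 / - t" t] assms
      by (simp add: ln_abs ln_minus)
  qed
  then have "((\<lambda>s. complex_of_real (ln \<bar>s\<bar>)) has_vector_derivative of_real (1 / t)) (at t)"
    by (rule has_vector_derivative_of_real)
  then have "((\<lambda>s. e * (complex_of_real (ln \<bar>s\<bar>) + c)) has_vector_derivative e * of_real (1 / t)) (at t)"
    by (intro has_vector_derivative_mult_right) (simp only: has_vector_derivative_add_const)
  from field_vector_diff_chain_at[OF this DERIV_exp]
  have "((\<lambda>s. exp (e * (of_real (ln \<bar>s\<bar>) + c))) has_vector_derivative
      e * of_real (1 / t) * exp (e * (of_real (ln \<bar>t\<bar>) + c))) (at t)"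
    by (simp add: o_def)
  moreover have "open U" "t \<in> U" using assms by (auto simp: U_def)
  ultimately show ?thesis
    using has_vector_derivative_transform_within_open[OF _ \<open>open U\<close> \<open>t \<in> U\<close> eq] eq[of t] by simp
qed

lemma has_vector_derivative_bessel_entire:
  "((\<lambda>t. bessel_entire \<mu> (of_real ((t / 2)\<^sup>2))) has_vector_derivative
     - of_real (t / 2) * bessel_entire (\<mu> + 1) (of_real ((t / 2)\<^sup>2))) (at t)"
proof -
  have "((\<lambda>t. (t / 2)\<^sup>2) has_real_derivative t / 2) (at t)"
    by (auto intro!: derivative_eq_intros)
  then have "((\<lambda>t. complex_of_real ((t / 2)\<^sup>2)) has_vector_derivative of_real (t / 2)) (at t)"
    by (rule has_vector_derivative_of_real)
  from field_vector_diff_chain_at[OF this DERIV_bessel_entire[of \<mu>]] show ?thesis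
    by (simp add: o_def)
qed

text \<open>The product rule yields the form with \<open>J\<close> of order
  \<open>\<mu> + 1\<close>. The recurrence turns it into the one that lowers the order, which is
  what makes \<open>J\<close> of order \<open>e\<close> a primitive for terms of order
  \<open>e - 1\<close>.\<close>

lemma has_vector_derivative_BesselJ:
  assumes "t \<noteq> 0"
  shows "((\<lambda>t. BesselJ \<mu> (of_real t)) has_vector_derivative
    BesselJ (\<mu> - 1) (of_real t) - \<mu> / of_real t * BesselJ \<mu> (of_real t)) (at t)"
proof -
  let ?P = "complex_of_real (t / 2) powr \<mu>" and ?\<Phi> = "\<lambda>\<mu>. bessel_entire \<mu> (of_real ((t / 2)\<^sup>2))"
  have "((\<lambda>t. t / 2) has_real_derivative 1 / 2) (at t)"
    by (auto intro!: derivative_eq_intros)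
  then have "((\<lambda>t. t / 2) has_vector_derivative 1 / 2) (at t)"
    by (simp only: has_real_derivative_iff_has_vector_derivative)
  from vector_diff_chain_at[OF this has_vector_derivative_powr_of_real[of "t / 2" \<mu>]]
  have "((\<lambda>t. complex_of_real (t / 2) powr \<mu>) has_vector_derivative \<mu> / of_real t * ?P) (at t)"
    using assms by (simp add: o_def scaleR_conv_of_real)
  from has_vector_derivative_mult[OF this has_vector_derivative_bessel_entire[of \<mu> t]]
  have "((\<lambda>t. of_real (t / 2) powr \<mu> * bessel_entire \<mu> (of_real ((t / 2)\<^sup>2))) has_vector_derivative
      ?P * (- of_real (t / 2) * ?\<Phi> (\<mu> + 1)) + \<mu> / of_real t * ?P * ?\<Phi> \<mu>) (at t)" .
  moreover have "?P * (- of_real (t / 2) * ?\<Phi> (\<mu> + 1)) + \<mu> / of_real t * ?P * ?\<Phi> \<mu> =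
      BesselJ (\<mu> - 1) (of_real t) - \<mu> / of_real t * BesselJ \<mu> (of_real t)"
  proof -
    have "complex_of_real (t / 2) powr (\<mu> + 1) = of_real (t / 2) * ?P"
      using powr_add[of "of_real (t / 2) :: complex" \<mu> 1] assms by (simp add: mult.commute)
    then have "?P * (- of_real (t / 2) * ?\<Phi> (\<mu> + 1)) = - BesselJ (\<mu> + 1) (of_real t)"
      using assms by (simp add: BesselJ_of_real)
    moreover have "BesselJ \<mu> (of_real t) = ?P * ?\<Phi> \<mu>"
      using assms by (rule BesselJ_of_real)
    moreover have "BesselJ (\<mu> - 1) (of_real t) + BesselJ (\<mu> + 1) (of_real t) = 2 * \<mu> / of_real t * BesselJ \<mu> (of_real t)"
      using BesselJ_recurrence[OF assms, of "\<mu> - 1"] by (simp add: add.commute)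
    then have "BesselJ (\<mu> - 1) (of_real t) = 2 * (\<mu> / of_real t * BesselJ \<mu> (of_real t)) - BesselJ (\<mu> + 1) (of_real t)"
      by (simp add: algebra_simps)
    ultimately show ?thesis by simp
  qed
  ultimately have "((\<lambda>t. of_real (t / 2) powr \<mu> * bessel_entire \<mu> (of_real ((t / 2)\<^sup>2))) has_vector_derivative
      BesselJ (\<mu> - 1) (of_real t) - \<mu> / of_real t * BesselJ \<mu> (of_real t)) (at t)"
    by simp
  then show ?thesis
    by (rule has_vector_derivative_transform_within_open[where S = "- {0}"]) (use assms in \<open>auto simp: BesselJ_of_real\<close>)
qed

text \<open>On the negative axis the principal power contributes a factor of norm
  \<open>exp (- Im \<mu> * pi)\<close>, and the rest of \<open>J\<close> is even. Estimates for
  \<open>t \<ge> 0\<close> thus carry over at the cost of a constant.\<close>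

lemma norm_BesselJ_of_real_abs:
  "norm (BesselJ \<mu> (of_real t)) \<le> exp (\<bar>Im \<mu>\<bar> * pi) * norm (BesselJ \<mu> (of_real \<bar>t\<bar>))"
proof (cases "t < 0")
  case True
  have "- (Im \<mu> * pi) \<le> \<bar>Im \<mu>\<bar> * pi"
    by (metis abs_mult abs_of_pos abs_ge_minus_self pi_gt_zero)
  then have "exp (- Im \<mu> * pi) \<le> exp (\<bar>Im \<mu>\<bar> * pi)" by simp
  moreover have "norm (BesselJ \<mu> (of_real t)) = exp (- Im \<mu> * pi) * norm (BesselJ \<mu> (of_real \<bar>t\<bar>))"
    using True BesselJ_of_real[of t \<mu>] BesselJ_of_real[of "\<bar>t\<bar>" \<mu>]
    by (simp add: norm_mult norm_powr_complex Arg_of_real del: of_real_divide of_real_minus)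
  ultimately show ?thesis by (simp add: mult_right_mono)
next
  case False
  have "1 \<le> exp (\<bar>Im \<mu>\<bar> * pi)" by simp
  with False show ?thesis
    using mult_right_mono[of 1 "exp (\<bar>Im \<mu>\<bar> * pi)" "norm (BesselJ \<mu> (of_real t))"] by simp
qed

text \<open>Only 0 needs care: there the power tends to 0 like
  \<open>\<bar>t\<bar> powr Re \<mu>\<close>, which matches the default value.\<close>

lemma continuous_on_BesselJ:
  assumes "Re \<mu> > 0"
  shows "continuous_on S (\<lambda>t. BesselJ \<mu> (of_real t))"
proof -
  have "isCont (\<lambda>t. BesselJ \<mu> (of_real t)) t" for t
  proof (cases "t = 0")
    case False
    then show ?thesis using has_vector_derivative_BesselJ has_vector_derivative_continuous by blast
  next
    case True
    have powr: "((\<lambda>t. \<bar>t / 2\<bar> powr Re \<mu>) \<longlongrightarrow> 0) (at 0)"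
      by (rule tendsto_zero_powrI[where b = "Re \<mu>"]) (use assms in \<open>auto intro!: tendsto_eq_intros\<close>)
    have cont: "isCont (\<lambda>t. bessel_entire \<mu> (of_real ((t / 2)\<^sup>2))) 0"
      using has_vector_derivative_bessel_entire has_vector_derivative_continuous by blast
    from tendsto_mult[OF tendsto_const tendsto_mult[OF powr tendsto_norm[OF isContD[OF cont]]]]
    have lim: "((\<lambda>t. exp (\<bar>Im \<mu>\<bar> * pi) * (\<bar>t / 2\<bar> powr Re \<mu> * norm (bessel_entire \<mu> (of_real ((t / 2)\<^sup>2))))) \<longlongrightarrow> 0) (at 0)"
      by (simp only: mult_zero_left mult_zero_right)
    have bound: "norm (BesselJ \<mu> (of_real t)) \<le>
        exp (\<bar>Im \<mu>\<bar> * pi) * (\<bar>t / 2\<bar> powr Re \<mu> * norm (bessel_entire \<mu> (of_real ((t / 2)\<^sup>2))))"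
      if "t \<noteq> 0" for t
    proof -
      have "norm (BesselJ \<mu> (of_real \<bar>t\<bar>)) = \<bar>t / 2\<bar> powr Re \<mu> * norm (bessel_entire \<mu> (of_real ((t / 2)\<^sup>2)))"
        using that BesselJ_of_real[of "\<bar>t\<bar>" \<mu>]
        by (simp add: norm_mult norm_powr_complex Arg_of_real power_divide del: of_real_divide)
      then show ?thesis using norm_BesselJ_of_real_abs[of \<mu> t] by simp
    qed
    have "((\<lambda>t. BesselJ \<mu> (of_real t)) \<longlongrightarrow> 0) (at 0)"
      by (rule Lim_null_comparison[OF _ lim])
         (unfold eventually_at_filter, intro always_eventually allI impI bound)
    moreover have "\<mu> \<noteq> 0" using assms by auto
    ultimately show ?thesis using True by (simp add: isCont_def BesselJ_zero)
  qed
  then show ?thesis by (simp add: continuous_at_imp_continuous_on)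
qed

text \<open>Any multiple \<open>u\<close> of \<open>sqrt t * J t\<close> solves \<open>u'' = - (1 + (1/4 - \<mu>\<^sup>2) / t\<^sup>2) u\<close>, so its energy
  \<open>|u|\<^sup>2 + |u'|\<^sup>2\<close> grows at most by the factor \<open>exp (c - c / t)\<close> on \<open>[1, t]\<close>, where \<open>c = |1/4 - \<mu>\<^sup>2|\<close>.\<close>

lemma BesselJ_decay_at_top:
  obtains C where "\<And>t. t \<ge> 1 \<Longrightarrow> norm (BesselJ \<mu> (of_real t)) * sqrt t \<le> C"
proof -
  define P where "P = (\<lambda>t. complex_of_real t powr (\<mu> + 1/2))"
  define \<Phi> where "\<Phi> = (\<lambda>k t. bessel_entire (\<mu> + of_nat k) (of_real ((t / 2)\<^sup>2)))"
  \<comment> \<open>Up to the constant \<open>2 powr \<mu>\<close> this is \<open>sqrt t\<close>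
    times the Bessel function. \<open>v\<close> is the derivative of \<open>u\<close>, and
    \<open>q\<close> is the perturbation in \<open>u'' = - (1 + q) u\<close>.\<close>
  define u where "u = (\<lambda>t. P t * \<Phi> 0 t)"
  define v where "v = (\<lambda>t. (\<mu> + 1/2) * (P t * \<Phi> 0 t / of_real t) - of_real t * P t * \<Phi> 1 t / 2)"
  define q where "q = (\<lambda>t. (1/4 - \<mu>\<^sup>2) / of_real t ^ 2)"
  define c where "c = norm (1/4 - \<mu>\<^sup>2)"
  have dP: "(P has_vector_derivative (\<mu> + 1/2) / of_real t * P t) (at t)" if "t > 0" for t
    unfolding P_def by (rule has_vector_derivative_powr_of_real) (use that in auto)
  have d\<Phi>: "(\<Phi> k has_vector_derivative - of_real (t / 2) * \<Phi> (Suc k) t) (at t)" for k t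
    using has_vector_derivative_bessel_entire[of "\<mu> + of_nat k" t] unfolding \<Phi>_def by (simp add: add_ac)
  have did: "(complex_of_real has_vector_derivative 1) (at t)" for t
    using has_vector_derivative_of_real[OF DERIV_ident] by simp
  have dinv: "((\<lambda>t. inverse (complex_of_real t)) has_vector_derivative - inverse (of_real t ^ 2)) (at t)"
    if "t > 0" for t
    using field_vector_diff_chain_at[OF did DERIV_inverse[of "complex_of_real t"]] that
    by (simp add: o_def power2_eq_square)
  have du: "(u has_vector_derivative v t) (at t)" if "t > 0" for t
    using has_vector_derivative_mult[OF dP[OF that] d\<Phi>[of 0 t]]
    by (simp add: u_def v_def algebra_simps)
  have dv: "(v has_vector_derivative - (u t) - q t * u t) (at t)" if "t > 0" for t
  proof -
    have t: "complex_of_real t \<noteq> 0" using that by simp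
    have rec: "\<Phi> 0 t = (\<mu> + 1) * \<Phi> 1 t - of_real (t / 2) ^ 2 * \<Phi> 2 t"
      using bessel_entire_recurrence[of \<mu> "of_real ((t / 2)\<^sup>2)"] by (simp add: \<Phi>_def)
    have d0: "(\<Phi> 0 has_vector_derivative - of_real (t / 2) * \<Phi> 1 t) (at t)"
      using d\<Phi>[of 0 t] by (simp only: One_nat_def)
    have d1: "(\<Phi> 1 has_vector_derivative - of_real (t / 2) * \<Phi> 2 t) (at t)"
      using d\<Phi>[of 1 t] by (simp only: Suc_1)
    have "(v has_vector_derivative
       (\<mu> + 1/2) * (P t * \<Phi> 0 t * (- inverse (of_real t ^ 2))
           + (P t * (- of_real (t / 2) * \<Phi> 1 t) + (\<mu> + 1/2) / of_real t * P t * \<Phi> 0 t) * inverse (of_real t))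
       - (of_real t * P t * (- of_real (t / 2) * \<Phi> 2 t)
           + (of_real t * ((\<mu> + 1/2) / of_real t * P t) + 1 * P t) * \<Phi> 1 t) * inverse 2) (at t)"
      unfolding v_def divide_inverse[of "P _ * _"] divide_inverse[of "_ * _ * _" 2]
      by (intro has_vector_derivative_diff has_vector_derivative_mult_right
            has_vector_derivative_mult_left[of "\<lambda>t. of_real t * P t * \<Phi> 1 t"]
            has_vector_derivative_mult dP[OF that] d0 d1 dinv[OF that] did)
    moreover have "(\<mu> + 1/2) * (P t * \<Phi> 0 t * (- inverse (of_real t ^ 2))
           + (P t * (- of_real (t / 2) * \<Phi> 1 t) + (\<mu> + 1/2) / of_real t * P t * \<Phi> 0 t) * inverse (of_real t))
       - (of_real t * P t * (- of_real (t / 2) * \<Phi> 2 t)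
           + (of_real t * ((\<mu> + 1/2) / of_real t * P t) + 1 * P t) * \<Phi> 1 t) * inverse 2
       = - (u t) - q t * u t"
    proof -
      have "- P t * ((\<mu> + 1) * \<Phi> 1 t - of_real (t / 2) ^ 2 * \<Phi> 2 t) = - u t"
        by (simp add: u_def rec)
      moreover have "(\<mu> + 1/2) * (P t * \<Phi> 0 t * (- inverse (of_real t ^ 2))
           + (P t * (- of_real (t / 2) * \<Phi> 1 t) + (\<mu> + 1/2) / of_real t * P t * \<Phi> 0 t) * inverse (of_real t))
       - (of_real t * P t * (- of_real (t / 2) * \<Phi> 2 t)
           + (of_real t * ((\<mu> + 1/2) / of_real t * P t) + 1 * P t) * \<Phi> 1 t) * inverse 2
        = - P t * ((\<mu> + 1) * \<Phi> 1 t - of_real (t / 2) ^ 2 * \<Phi> 2 t) - q t * u t"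
        using t unfolding q_def u_def by (simp add: field_simps power2_eq_square)
      ultimately show ?thesis by simp
    qed
    ultimately show ?thesis by simp
  qed
  \<comment> \<open>The weight has logarithmic derivative \<open>- c / t^2\<close>, just enough to
    absorb the growth of the energy. Since it is at least 1, \<open>F\<close> still dominates the
    square of \<open>norm (u t)\<close>.\<close>
  define F where "F = (\<lambda>t. (u t \<bullet> u t + v t \<bullet> v t) * exp (c / t))"
  have F_mono: "F t \<le> F 1" if "t \<ge> 1" for t
  proof (rule DERIV_nonpos_imp_nonincreasing[OF that])
    fix s :: real assume s: "1 \<le> s" "s \<le> t"
    then have s0: "s > 0" by simp
    let ?D = "2 * (u s \<bullet> v s) + 2 * (v s \<bullet> (- u s - q s * u s))"
    have inner: "((\<lambda>s. w s \<bullet> w s) has_real_derivative 2 * (w s \<bullet> w')) (at s)"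
      if "(w has_vector_derivative w') (at s)" for w :: "real \<Rightarrow> complex" and w'
      using bounded_bilinear.has_vector_derivative[OF bounded_bilinear_inner that that]
      by (simp add: has_real_derivative_iff_has_vector_derivative inner_commute)
    have "((\<lambda>s. exp (c / s)) has_real_derivative - (c / s\<^sup>2) * exp (c / s)) (at s)"
      using s0 by (auto intro!: derivative_eq_intros simp: power2_eq_square)
    from DERIV_mult[OF DERIV_add[OF inner[OF du[OF s0]] inner[OF dv[OF s0]]] this]
    have "(F has_real_derivative (?D - c / s\<^sup>2 * (u s \<bullet> u s + v s \<bullet> v s)) * exp (c / s)) (at s)"
      unfolding F_def by (rule DERIV_cong) (simp add: algebra_simps add_divide_distrib)
    moreover have "?D \<le> c / s\<^sup>2 * (u s \<bullet> u s + v s \<bullet> v s)"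
    proof -
      \<comment> \<open>The unperturbed oscillator conserves energy: the terms
        \<open>u s \<bullet> v s\<close> cancel and only the perturbation \<open>q\<close>
        remains.\<close>
      have "?D = - 2 * (v s \<bullet> (q s * u s))"
        by (simp add: inner_diff_right inner_commute)
      also have "\<dots> \<le> 2 * (norm (v s) * norm (q s * u s))"
        using Cauchy_Schwarz_ineq2[of "v s" "q s * u s"] by (simp add: abs_le_iff)
      also have "\<dots> = norm (q s) * (2 * (norm (v s) * norm (u s)))"
        by (simp add: norm_mult)
      also have "\<dots> \<le> norm (q s) * ((norm (u s))\<^sup>2 + (norm (v s))\<^sup>2)"
        using sum_squares_bound[of "norm (v s)" "norm (u s)"] by (intro mult_left_mono) auto
      also have "\<dots> = c / s\<^sup>2 * (u s \<bullet> u s + v s \<bullet> v s)"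
        by (simp add: q_def c_def norm_divide norm_power power2_norm_eq_inner)
      finally show ?thesis .
    qed
    then have "(?D - c / s\<^sup>2 * (u s \<bullet> u s + v s \<bullet> v s)) * exp (c / s) \<le> 0"
      by (intro mult_nonpos_nonneg) auto
    ultimately show "\<exists>y. (F has_real_derivative y) (at s) \<and> y \<le> 0" by blast
  qed
  have u_bound: "norm (u t) \<le> sqrt (F 1)" if "t \<ge> 1" for t
  proof -
    have "(norm (u t))\<^sup>2 * 1 \<le> F t"
      unfolding F_def power2_norm_eq_inner using that by (intro mult_mono) (auto simp: c_def)
    also have "\<dots> \<le> F 1" by (rule F_mono[OF that])
    finally show ?thesis by (simp add: real_le_rsqrt)
  qed
  define K where "K = norm ((1/2 :: complex) powr \<mu>)"
  have J: "norm (BesselJ \<mu> (of_real t)) * sqrt t = K * norm (u t)" if "t \<ge> 1" for t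
  proof -
    have "complex_of_real (t / 2) = 1/2 * of_real t" by simp
    then have "complex_of_real (t / 2) powr \<mu> = (1/2) powr \<mu> * of_real t powr \<mu>"
      using powr_times_real[of "1/2" "complex_of_real t" \<mu>] that by simp
    then have "BesselJ \<mu> (of_real t) = (1/2) powr \<mu> * of_real t powr \<mu> * \<Phi> 0 t"
      using BesselJ_of_real[of t \<mu>] that by (simp add: \<Phi>_def)
    moreover have "norm (complex_of_real t powr (1/2)) = sqrt t"
      using that by (simp add: norm_powr_real_powr powr_half_sqrt)
    then have "norm (P t) = norm (complex_of_real t powr \<mu>) * sqrt t"
      unfolding P_def powr_add norm_mult by simp
    ultimately show ?thesis
      unfolding u_def K_def by (simp only: norm_mult mult_ac)
  qed
  show thesis
  proof (rule that)
    fix t :: real assume t: "t \<ge> 1"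
    show "norm (BesselJ \<mu> (of_real t)) * sqrt t \<le> K * sqrt (F 1)"
      unfolding J[OF t] by (intro mult_left_mono u_bound t) (simp add: K_def)
  qed
qed

text \<open>Compactness covers \<open>[0, 1]\<close>. From 1 on the decay implies boundedness as
  well, because \<open>sqrt t \<ge> 1\<close>. The factor \<open>E\<close> pays for the reflection
  to negative \<open>t\<close>.\<close>

lemma BesselJ_bounds:
  assumes "Re \<mu> > 0"
  shows "\<exists>C\<ge>0. \<forall>t. norm (BesselJ \<mu> (of_real t)) \<le> C \<and> norm (BesselJ \<mu> (of_real t)) * sqrt \<bar>t\<bar> \<le> C"
proof -
  obtain C1 where C1: "\<And>t. t \<ge> 1 \<Longrightarrow> norm (BesselJ \<mu> (of_real t)) * sqrt t \<le> C1"
    using BesselJ_decay_at_top[of \<mu>] by blast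
  have "compact ((\<lambda>t. BesselJ \<mu> (of_real t)) ` {0..1})"
    by (intro compact_continuous_image continuous_on_BesselJ assms) simp
  then obtain C2 where C2: "\<And>t. t \<in> {0..1} \<Longrightarrow> norm (BesselJ \<mu> (of_real t)) \<le> C2"
    unfolding bounded_iff[THEN iffD1] using compact_imp_bounded bounded_iff by (metis image_eqI)
  let ?M = "max C1 C2"
  have nonneg: "norm (BesselJ \<mu> (of_real t)) \<le> ?M \<and> norm (BesselJ \<mu> (of_real t)) * sqrt t \<le> ?M"
    if "t \<ge> 0" for t
  proof (cases "t \<ge> 1")
    case True
    then have "norm (BesselJ \<mu> (of_real t)) * 1 \<le> norm (BesselJ \<mu> (of_real t)) * sqrt t"
      by (intro mult_left_mono) auto
    with C1[OF True] show ?thesis by linarith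
  next
    case False
    then have "norm (BesselJ \<mu> (of_real t)) * sqrt t \<le> norm (BesselJ \<mu> (of_real t)) * 1"
      using that by (intro mult_left_mono) auto
    with C2[of t] False that show ?thesis by auto
  qed
  have M: "0 \<le> ?M" using nonneg[of 0] norm_ge_zero order_trans by blast
  define E where "E = exp (\<bar>Im \<mu>\<bar> * pi)"
  have E: "E > 0" by (simp add: E_def)
  show ?thesis
  proof (intro exI[of _ "E * ?M"] conjI allI)
    show "E * ?M \<ge> 0" using M E by simp
    fix t :: real
    have "norm (BesselJ \<mu> (of_real t)) \<le> E * norm (BesselJ \<mu> (of_real \<bar>t\<bar>))"
      unfolding E_def by (rule norm_BesselJ_of_real_abs)
    moreover have "E * norm (BesselJ \<mu> (of_real \<bar>t\<bar>)) \<le> E * ?M"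
      using nonneg[of "\<bar>t\<bar>"] E by (intro mult_left_mono) auto
    ultimately show "norm (BesselJ \<mu> (of_real t)) \<le> E * ?M" by linarith
    have "norm (BesselJ \<mu> (of_real t)) * sqrt \<bar>t\<bar> \<le> E * norm (BesselJ \<mu> (of_real \<bar>t\<bar>)) * sqrt \<bar>t\<bar>"
      unfolding E_def by (intro mult_right_mono norm_BesselJ_of_real_abs) simp
    also have "\<dots> \<le> E * ?M"
      using nonneg[of "\<bar>t\<bar>"] E by (simp add: mult.assoc)
    finally show "norm (BesselJ \<mu> (of_real t)) * sqrt \<bar>t\<bar> \<le> E * ?M" .
  qed
qed

text \<open>The recurrence read as a formula for the quotient that has no singularity at 0. There
  both sides are 0: the left by \<open>x / 0 = 0\<close>, the right because neither order
  \<open>\<mu> - 1\<close> nor \<open>\<mu> + 1\<close> is 0.\<close>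

lemma BesselJ_div_eq:
  assumes "Re \<mu> > 1"
  shows "BesselJ \<mu> (of_real t) / of_real t =
    (BesselJ (\<mu> - 1) (of_real t) + BesselJ (\<mu> + 1) (of_real t)) / (2 * \<mu>)"
proof -
  have nz: "\<mu> \<noteq> 0" "\<mu> - 1 \<noteq> 0" "\<mu> + 1 \<noteq> 0" using assms by (auto simp: complex_eq_iff)
  show ?thesis
  proof (cases "t = 0")
    case True
    then show ?thesis using nz by (simp add: BesselJ_zero)
  next
    case False
    then show ?thesis
      using BesselJ_recurrence[OF False, of "\<mu> - 1"] nz by (simp add: field_simps)
  qed
qed

lemma continuous_on_BesselJ_div:
  assumes "Re \<mu> > 1"
  shows "continuous_on S (\<lambda>t. BesselJ \<mu> (of_real t) / of_real t)"
  unfolding BesselJ_div_eq[OF assms]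
  by (intro continuous_intros continuous_on_BesselJ) (use assms in auto)

text \<open>Boundedness near 0 and decay like \<open>t^(-3/2)\<close> are merged into one majorant
  that is integrable over the whole line.\<close>

lemma BesselJ_div_bound:
  assumes "Re \<mu> > 1"
  shows "\<exists>C\<ge>0. \<forall>t. norm (BesselJ \<mu> (of_real t) / of_real t) \<le> C / ((1 + \<bar>t\<bar>) * sqrt (1 + \<bar>t\<bar>))"
proof -
  have pos: "Re (\<mu> - 1) > 0" "Re (\<mu> + 1) > 0" "Re \<mu> > 0" using assms by auto
  obtain C1 where C1: "C1 \<ge> 0" "\<And>t. norm (BesselJ (\<mu> - 1) (of_real t)) \<le> C1"
    using BesselJ_bounds[OF pos(1)] by meson
  obtain C2 where C2: "C2 \<ge> 0" "\<And>t. norm (BesselJ (\<mu> + 1) (of_real t)) \<le> C2"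
    using BesselJ_bounds[OF pos(2)] by meson
  obtain C3 where C3: "C3 \<ge> 0" "\<And>t. norm (BesselJ \<mu> (of_real t)) * sqrt \<bar>t\<bar> \<le> C3"
    using BesselJ_bounds[OF pos(3)] by meson
  define A where "A = (C1 + C2) / norm (2 * \<mu>)"
  \<comment> \<open>The 4 bounds the weight \<open>?w\<close>: it is at most \<open>2 * 2\<close>
    for \<open>\<bar>t\<bar> \<le> 1\<close>, and at most \<open>2 * \<bar>t\<bar>\<close> times
    \<open>2 * sqrt \<bar>t\<bar>\<close> beyond.\<close>
  define C where "C = 4 * (A + C3)"
  have A0: "A \<ge> 0" using C1 C2 by (simp add: A_def)
  have A: "norm (BesselJ \<mu> (of_real t) / of_real t) \<le> A" for t
    unfolding BesselJ_div_eq[OF assms] A_def norm_divide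
    by (intro divide_right_mono order_trans[OF norm_triangle_ineq] add_mono C1 C2) auto
  show ?thesis
  proof (intro exI[of _ C] conjI allI)
    show "C \<ge> 0" using A0 C3 by (simp add: C_def)
    fix t :: real
    let ?j = "norm (BesselJ \<mu> (of_real t) / of_real t)" and ?w = "(1 + \<bar>t\<bar>) * sqrt (1 + \<bar>t\<bar>)"
    have w: "?w > 0" by (simp add: add_pos_nonneg)
    have "?j * ?w \<le> C"
    proof (cases "\<bar>t\<bar> \<le> 1")
      case True
      have "sqrt (1 + \<bar>t\<bar>) \<le> 2" by (rule real_le_lsqrt) (use True in auto)
      then have "?w \<le> 2 * 2" using True by (intro mult_mono) auto
      then have "?j * ?w \<le> A * 4" using A[of t] A0 w by (intro mult_mono) auto
      then show ?thesis using C3(1) A0 by (simp add: C_def)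
    next
      case False
      have "sqrt (1 + \<bar>t\<bar>) \<le> sqrt (4 * \<bar>t\<bar>)" using False by (intro real_sqrt_le_mono) auto
      also have "\<dots> = 2 * sqrt \<bar>t\<bar>" by (simp add: real_sqrt_mult)
      finally have "?w \<le> (2 * \<bar>t\<bar>) * (2 * sqrt \<bar>t\<bar>)" using False by (intro mult_mono) auto
      then have "?j * ?w \<le> ?j * ((2 * \<bar>t\<bar>) * (2 * sqrt \<bar>t\<bar>))" by (intro mult_left_mono) auto
      also have "\<dots> = 4 * (norm (BesselJ \<mu> (of_real t)) * sqrt \<bar>t\<bar>)"
        using False by (simp add: norm_divide)
      also have "\<dots> \<le> C" using C3(2)[of t] A0 by (simp add: C_def)
      finally show ?thesis .
    qed
    then show "?j \<le> C / ?w" using w by (simp add: pos_le_divide_eq)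
  qed
qed

subsection \<open>Bessel integrals with one zero of the phase\<close>

text \<open>At 0 only continuity is asked of the primitive \<open>F\<close>, so
  \<open>\<phi>\<close> may blow up there. The fundamental theorem is applied on each side of
  \<open>\<xi>\<close>.\<close>

lemma has_integral_of_dist:
  fixes F \<phi> :: "real \<Rightarrow> real"
  assumes "a \<le> \<xi>" "\<xi> \<le> b" "continuous_on {0..} F" "F 0 = 0"
    and F: "\<And>y. y > 0 \<Longrightarrow> (F has_real_derivative \<phi> y) (at y)"
  shows "((\<lambda>x. \<phi> \<bar>x - \<xi>\<bar>) has_integral F (\<xi> - a) + F (b - \<xi>)) {a..b}"
proof -
  have "((\<lambda>x. \<phi> \<bar>x - \<xi>\<bar>) has_integral (- F (\<xi> - \<xi>)) - (- F (\<xi> - a))) {a..\<xi>}"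
  proof (rule fundamental_theorem_of_calculus_interior[where f = "\<lambda>x. - F (\<xi> - x)"])
    show "continuous_on {a..\<xi>} (\<lambda>x. - F (\<xi> - x))"
      by (intro continuous_intros continuous_on_compose2[OF assms(3)]) auto
    fix x assume x: "x \<in> {a<..<\<xi>}"
    have "((\<lambda>x. F (\<xi> - x)) has_real_derivative \<phi> (\<xi> - x) * (-1)) (at x)"
      by (rule DERIV_chain2[OF F]) (use x in \<open>auto intro!: derivative_eq_intros\<close>)
    then show "((\<lambda>x. - F (\<xi> - x)) has_vector_derivative \<phi> \<bar>x - \<xi>\<bar>) (at x)"
      using x by (auto intro!: derivative_eq_intros simp flip: has_real_derivative_iff_has_vector_derivative)
  qed (use assms in auto)
  moreover have "((\<lambda>x. \<phi> \<bar>x - \<xi>\<bar>) has_integral F (b - \<xi>) - F (\<xi> - \<xi>)) {\<xi>..b}"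
  proof (rule fundamental_theorem_of_calculus_interior[where f = "\<lambda>x. F (x - \<xi>)"])
    show "continuous_on {\<xi>..b} (\<lambda>x. F (x - \<xi>))"
      by (intro continuous_intros continuous_on_compose2[OF assms(3)]) auto
    fix x assume x: "x \<in> {\<xi><..<b}"
    have "((\<lambda>x. F (x - \<xi>)) has_real_derivative \<phi> (x - \<xi>) * 1) (at x)"
      by (rule DERIV_chain2[OF F]) (use x in \<open>auto intro!: derivative_eq_intros\<close>)
    then show "((\<lambda>x. F (x - \<xi>)) has_vector_derivative \<phi> \<bar>x - \<xi>\<bar>) (at x)"
      using x by (simp flip: has_real_derivative_iff_has_vector_derivative)
  qed (use assms in auto)
  ultimately show ?thesis
    using has_integral_combine[OF assms(1,2)] assms(4) by fastforce
qed

lemma has_integral_inverse_sqrt_dist: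
  assumes "a \<le> \<xi>" "\<xi> \<le> b"
  shows "((\<lambda>x. 1 / sqrt \<bar>x - \<xi>\<bar>) has_integral 2 * sqrt (\<xi> - a) + 2 * sqrt (b - \<xi>)) {a..b}"
proof -
  have "((\<lambda>y. 2 * sqrt y) has_real_derivative 1 / sqrt y) (at y)" if "y > 0" for y
    by (rule DERIV_cong[OF DERIV_cmult[OF DERIV_real_sqrt[OF that]]]) (simp add: field_simps)
  moreover have "continuous_on {0..} (\<lambda>y::real. 2 * sqrt y)"
    by (intro continuous_intros)
  ultimately show ?thesis
    using has_integral_of_dist[of a \<xi> b "\<lambda>y. 2 * sqrt y" "\<lambda>y. 1 / sqrt y"] assms by simp
qed

text \<open>On a half-line the integral of \<open>(1 + r * y) powr (-3/2)\<close> is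
  \<open>2 / r\<close>, and there are two halves. The factor \<open>1 / r\<close> is the point: the
  bound later offsets a factor \<open>\<omega>\<close>.\<close>

lemma integral_decay_le:
  assumes "a \<le> \<xi>" "\<xi> \<le> b" "r > 0"
  shows "(\<lambda>x. 1 / ((1 + r * \<bar>x - \<xi>\<bar>) * sqrt (1 + r * \<bar>x - \<xi>\<bar>))) integrable_on {a..b}"
    and "integral {a..b} (\<lambda>x. 1 / ((1 + r * \<bar>x - \<xi>\<bar>) * sqrt (1 + r * \<bar>x - \<xi>\<bar>))) \<le> 4 / r"
proof -
  define F where "F = (\<lambda>y. 2 / r * (1 - inverse (sqrt (1 + r * y))))"
  have pos: "1 + r * y > 0" if "y \<ge> 0" for y
    using assms that by (simp add: add_pos_nonneg)
  have hi: "((\<lambda>x. 1 / ((1 + r * \<bar>x - \<xi>\<bar>) * sqrt (1 + r * \<bar>x - \<xi>\<bar>))) has_integral F (\<xi> - a) + F (b - \<xi>)) {a..b}"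
  proof (rule has_integral_of_dist[OF assms(1,2), where F = F and \<phi> = "\<lambda>y. 1 / ((1 + r * y) * sqrt (1 + r * y))"])
    have "sqrt (1 + r * y) \<noteq> 0" if "y \<in> {0..}" for y
      using pos[of y] that by simp
    then show "continuous_on {0..} F"
      unfolding F_def by (intro continuous_intros) auto
    show "F 0 = 0" by (simp add: F_def)
    fix y :: real assume "y > 0"
    then have p: "1 + r * y > 0" using pos[of y] by simp
    have "((\<lambda>y. inverse (sqrt (1 + r * y))) has_real_derivative
        - (inverse (sqrt (1 + r * y)) / 2 * r) * (inverse (sqrt (1 + r * y)) * inverse (sqrt (1 + r * y)))) (at y)"
      using p by (auto intro!: derivative_eq_intros simp: power2_eq_square field_simps)
    then have "(F has_real_derivative 2 / r * (0 - (- (inverse (sqrt (1 + r * y)) / 2 * r) *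
        (inverse (sqrt (1 + r * y)) * inverse (sqrt (1 + r * y)))))) (at y)"
      unfolding F_def by (intro DERIV_cmult DERIV_diff DERIV_const)
    moreover have "inverse (sqrt (1 + r * y)) * inverse (sqrt (1 + r * y)) = inverse (1 + r * y)"
      using p by (simp flip: inverse_mult_distrib)
    moreover have "2 / r * (0 - (- (w / 2 * r) * z)) = w * z" for w z
      using assms(3) by simp
    ultimately have "(F has_real_derivative inverse (sqrt (1 + r * y)) * inverse (1 + r * y)) (at y)"
      by (simp only:)
    then show "(F has_real_derivative 1 / ((1 + r * y) * sqrt (1 + r * y))) (at y)"
      by (simp only: inverse_eq_divide times_divide_times_eq mult_1 mult.commute)
  qed
  show "(\<lambda>x. 1 / ((1 + r * \<bar>x - \<xi>\<bar>) * sqrt (1 + r * \<bar>x - \<xi>\<bar>))) integrable_on {a..b}"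
    using hi by blast
  have F_le: "F y \<le> 2 / r" if "y \<ge> 0" for y
    using pos[OF that] assms(3) unfolding F_def by (simp add: divide_right_mono)
  have "integral {a..b} (\<lambda>x. 1 / ((1 + r * \<bar>x - \<xi>\<bar>) * sqrt (1 + r * \<bar>x - \<xi>\<bar>))) = F (\<xi> - a) + F (b - \<xi>)"
    by (rule integral_unique[OF hi])
  also have "\<dots> \<le> 2 / r + 2 / r"
    using assms by (intro add_mono F_le) auto
  finally show "integral {a..b} (\<lambda>x. 1 / ((1 + r * \<bar>x - \<xi>\<bar>) * sqrt (1 + r * \<bar>x - \<xi>\<bar>))) \<le> 4 / r"
    by simp
qed

section \<open>Integration by parts along a phase with a single simple zero\<close>

locale bessel_phase =
  fixes a b \<xi> :: real and g :: "real \<Rightarrow> real"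
  assumes ab: "a < b" and xi: "\<xi> \<in> {a..b}"
    and g_smooth: "C_infinity_on {a..b} g"
    and g'_nz: "\<And>x. x \<in> {a..b} \<Longrightarrow> nderiv {a..b} 1 g x \<noteq> 0"
    and g_xi: "g \<xi> = 0" and g_nz: "\<And>x. x \<in> {a..b} \<Longrightarrow> x \<noteq> \<xi> \<Longrightarrow> g x \<noteq> 0"
begin

abbreviation "S \<equiv> {a..b}"
abbreviation "g' \<equiv> nderiv {a..b} 1 g"
abbreviation "G x \<equiv> complex_of_real (g x)"
abbreviation "G' x \<equiv> complex_of_real (g' x)"
abbreviation "J \<mu> \<omega> x \<equiv> BesselJ \<mu> (complex_of_real (\<omega> * g x))"

lemma deriv_g: "x \<in> S \<Longrightarrow> (g has_vector_derivative g' x) (at x within S)"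
  using g_smooth unfolding C_infinity_on_def by (metis One_nat_def nderiv.simps(1))

lemma deriv_G: "x \<in> S \<Longrightarrow> (G has_vector_derivative G' x) (at x within S)"
  by (rule has_vector_derivative_of_real)
     (simp only: deriv_g has_real_derivative_iff_has_vector_derivative)

lemma smooth_g: "smooth_on S g" and smooth_g': "smooth_on S g'"
  using C_infinity_on_imp_smooth_on[OF g_smooth, of 0] C_infinity_on_imp_smooth_on[OF g_smooth, of 1]
  by simp_all

lemma smooth_G: "smooth_on S G" and smooth_G': "smooth_on S G'"
  using smooth_g smooth_g' by (simp_all only: smooth_on_of_real)

lemma continuous_J:
  assumes "Re \<mu> > 0"
  shows "continuous_on S (J \<mu> \<omega>)"
  by (rule continuous_on_compose2[OF continuous_on_BesselJ[OF assms, of UNIV], of S "\<lambda>x. \<omega> * g x"])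
     (auto intro!: continuous_intros smooth_on_continuous[OF smooth_g])

lemma deriv_J:
  assumes "x \<in> S" "x \<noteq> \<xi>" "\<omega> \<noteq> 0"
  shows "(J e \<omega> has_vector_derivative
    of_real \<omega> * G' x * J (e - 1) \<omega> x - e * G' x / G x * J e \<omega> x) (at x within S)"
proof -
  have nz: "\<omega> * g x \<noteq> 0" using assms g_nz by simp
  have "((\<lambda>x. \<omega> * g x) has_vector_derivative \<omega> * g' x) (at x within S)"
    by (intro has_vector_derivative_mult_right deriv_g assms)
  from vector_diff_chain_within[OF this has_vector_derivative_at_within[OF has_vector_derivative_BesselJ[OF nz, of e]]]
  have "(J e \<omega> has_vector_derivative
    (\<omega> * g' x) *\<^sub>R (J (e - 1) \<omega> x - e / of_real (\<omega> * g x) * J e \<omega> x)) (at x within S)"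
    by (simp add: o_def)
  moreover have "(\<omega> * g' x) *\<^sub>R (J (e - 1) \<omega> x - e / of_real (\<omega> * g x) * J e \<omega> x)
      = of_real \<omega> * G' x * J (e - 1) \<omega> x - e * G' x / G x * J e \<omega> x"
    using nz by (simp add: scaleR_conv_of_real right_diff_distrib del: nderiv.simps)
  ultimately show ?thesis by simp
qed

text \<open>The primitive is \<open>q x * J e \<omega> x\<close>, without the complex power of
  \<open>g\<close> that the classical identity carries, so the sign of \<open>g\<close> does not
  matter. It is continuous at \<open>\<xi>\<close> since \<open>Re e > 0\<close>, and
  \<open>\<xi>\<close> is exempt from differentiation; hence the conclusion includes integrability
  even if \<open>J (e - 1) \<omega>\<close> is unbounded there. \<open>B\<close> is a continuous
  version of the remaining term, whose formula divides by \<open>G x\<close>.\<close>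

lemma integration_by_parts:
  assumes e: "Re e > 0" and \<omega>: "\<omega> \<noteq> 0"
    and q: "\<And>x. x \<in> S \<Longrightarrow> (q has_vector_derivative q' x) (at x within S)"
    and B: "continuous_on S B"
      "\<And>x. x \<in> S \<Longrightarrow> x \<noteq> \<xi> \<Longrightarrow> B x = (q' x - e * G' x * q x / G x) * J e \<omega> x"
  shows "((\<lambda>x. G' x * q x * J (e - 1) \<omega> x) has_integral
    (q b * J e \<omega> b - q a * J e \<omega> a - integral S B) / of_real \<omega>) S"
proof -
  have *: "((\<lambda>x. of_real \<omega> * (G' x * q x * J (e - 1) \<omega> x) + B x) has_integral (q b * J e \<omega> b - q a * J e \<omega> a)) S"
  proof (rule fundamental_theorem_of_calculus_interior_strong[of "{\<xi>}" a b "\<lambda>x. q x * J e \<omega> x"])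
    show "continuous_on {a..b} (\<lambda>x. q x * J e \<omega> x)"
    proof (intro continuous_on_mult continuous_J e)
      show "continuous_on {a..b} q"
        unfolding continuous_on_eq_continuous_within using q has_vector_derivative_continuous by blast
    qed
    fix x assume x: "x \<in> {a<..<b} - {\<xi>}"
    then have x': "x \<in> S" "x \<noteq> \<xi>" by auto
    then have gx: "G x \<noteq> 0" using g_nz by simp
    from has_vector_derivative_mult[OF q deriv_J[OF _ _ \<omega>, of _ e], of x] x'
    have "((\<lambda>x. q x * J e \<omega> x) has_vector_derivative
        q x * (of_real \<omega> * G' x * J (e - 1) \<omega> x - e * G' x / G x * J e \<omega> x) + q' x * J e \<omega> x) (at x within S)"
      by blast
    moreover have "q x * (of_real \<omega> * G' x * J (e - 1) \<omega> x - e * G' x / G x * J e \<omega> x) + q' x * J e \<omega> x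
        = of_real \<omega> * (G' x * q x * J (e - 1) \<omega> x) + B x"
      unfolding B(2)[OF x'] using gx by (simp add: field_simps del: nderiv.simps)
    moreover have "at x within S = at x" using x by (intro at_within_interior) auto
    ultimately show "((\<lambda>x. q x * J e \<omega> x) has_vector_derivative
        of_real \<omega> * (G' x * q x * J (e - 1) \<omega> x) + B x) (at x)" by simp
  qed (use ab in auto)
  have cancel: "inverse (of_real \<omega>) * (of_real \<omega> * z) = z" for z :: complex
    using \<omega> by simp
  from has_integral_diff[OF * integrable_integral[OF integrable_continuous_real[OF B(1)]]]
  have "((\<lambda>x. of_real \<omega> * (G' x * q x * J (e - 1) \<omega> x)) has_integral
      (q b * J e \<omega> b - q a * J e \<omega> a - integral S B)) S" by simp
  from has_integral_mult_right[OF this, of "inverse (of_real \<omega>)"] show ?thesis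
    unfolding cancel divide_inverse_commute .
qed

text \<open>The link between \<open>sigma_t\<close> and integration by parts. The function
  differentiated in \<open>sigma_t\<close> is \<open>q / G powr e\<close>; after the product rule
  the outer power cancels all the others, and what is left is exactly the coefficient of
  \<open>J e \<omega>\<close> in \<open>integration_by_parts\<close>.\<close>

lemma sigma_integrand_derivative:
  assumes q: "(q has_vector_derivative q') (at x within S)"
    and s: "\<And>t. t \<in> S \<Longrightarrow> s t = G' t * q t" "s \<xi> = 0" and x: "x \<in> S" "x \<noteq> \<xi>"
  shows "G x powr e * vector_derivative (\<lambda>t. (s t - s \<xi>) / (G t powr e * G' t)) (at x within S)
    = q' - e * G' x * q x / G x"
proof -
  have gx: "g x \<noteq> 0" using x g_nz by simp
  have P: "((\<lambda>t. G t powr e) has_vector_derivative g' x *\<^sub>R (e / G x * G x powr e)) (at x within S)"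
    using vector_diff_chain_within[OF deriv_g[OF x(1)] has_vector_derivative_at_within[OF has_vector_derivative_powr_of_real[OF gx]]]
    by (simp add: o_def)
  have Pnz: "G x powr e \<noteq> 0" using gx by simp
  from has_vector_derivative_mult[OF q has_vector_derivative_inverse_field[OF P Pnz]]
  have D: "((\<lambda>t. q t * inverse (G t powr e)) has_vector_derivative
     q x * (- (g' x *\<^sub>R (e / G x * G x powr e)) * (inverse (G x powr e) * inverse (G x powr e)))
      + q' * inverse (G x powr e)) (at x within S)" .
  have eq: "(s t - s \<xi>) / (G t powr e * G' t) = q t * inverse (G t powr e)" if "t \<in> S" for t
    using s that g'_nz[OF that] by (simp add: divide_inverse del: nderiv.simps)
  from has_vector_derivative_transform[OF x(1) eq D]
  have "vector_derivative (\<lambda>t. (s t - s \<xi>) / (G t powr e * G' t)) (at x within S) =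
     q x * (- (g' x *\<^sub>R (e / G x * G x powr e)) * (inverse (G x powr e) * inverse (G x powr e)))
      + q' * inverse (G x powr e)"
    using vector_derivative_within_cbox[of a b x] ab x by simp
  then show ?thesis
    using gx Pnz by (simp add: scaleR_conv_of_real field_simps del: nderiv.simps)
qed

text \<open>Each step trades one power of \<open>G\<close>, and one order of vanishing at the ends
  other than \<open>\<xi>\<close>, for a factor \<open>- 1 / \<omega>\<close> and a Bessel order
  higher by one. Integrability of the original integrand is guarded by \<open>k > 0\<close> because
  the first integration by parts is what establishes it.\<close>

lemma sigma_chain:
  assumes nu: "Re \<nu> > -1"
    and K0: "smooth_on S K0" "\<forall>x\<in>S. complex_of_real (h x) = G' x * G x ^ m * K0 x"
      "a \<noteq> \<xi> \<longrightarrow> vanishes_to m S a K0" "b \<noteq> \<xi> \<longrightarrow> vanishes_to m S b K0"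
  shows "k \<le> m \<Longrightarrow> \<exists>K. smooth_on S K \<and>
    (\<forall>x\<in>S. sigma_t \<nu> g \<xi> S h k x = G' x * G x ^ (m - k) * K x) \<and>
    (a \<noteq> \<xi> \<longrightarrow> vanishes_to (m - k) S a K) \<and> (b \<noteq> \<xi> \<longrightarrow> vanishes_to (m - k) S b K) \<and>
    (\<forall>\<omega>>0. (k > 0 \<longrightarrow> (\<lambda>x. of_real (h x) * J \<nu> \<omega> x) integrable_on S) \<and>
       integral S (\<lambda>x. of_real (h x) * J \<nu> \<omega> x) =
       (- 1 / of_real \<omega>) ^ k * integral S (\<lambda>x. G' x * G x ^ (m - k) * K x * J (\<nu> + of_nat k) \<omega> x))"
proof (induction k)
  case 0
  have "integral S (\<lambda>x. of_real (h x) * J \<nu> \<omega> x) = integral S (\<lambda>x. G' x * G x ^ m * K0 x * J \<nu> \<omega> x)" for \<omega>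
    by (intro integral_cong) (simp only: K0(2))
  then show ?case using K0 by (intro exI[of _ K0]) simp
next
  case (Suc k)
  have "k \<le> m" using Suc.prems by simp
  from Suc.IH[OF this] obtain K where IH: "smooth_on S K"
    "\<forall>x\<in>S. sigma_t \<nu> g \<xi> S h k x = G' x * G x ^ (m - k) * K x"
    "a \<noteq> \<xi> \<longrightarrow> vanishes_to (m - k) S a K" "b \<noteq> \<xi> \<longrightarrow> vanishes_to (m - k) S b K"
    "\<forall>\<omega>>0. (k > 0 \<longrightarrow> (\<lambda>x. of_real (h x) * J \<nu> \<omega> x) integrable_on S) \<and>
       integral S (\<lambda>x. of_real (h x) * J \<nu> \<omega> x) =
       (- 1 / of_real \<omega>) ^ k * integral S (\<lambda>x. G' x * G x ^ (m - k) * K x * J (\<nu> + of_nat k) \<omega> x)"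
    by (elim exE conjE) (rule that; assumption)
  note K = IH(1) bspec[OF IH(2)] mp[OF IH(3)] mp[OF IH(4)]
  note int_K = conjunct1[OF mp[OF spec[OF IH(5)]]] conjunct2[OF mp[OF spec[OF IH(5)]]]
  define i where "i = m - Suc k"
  have mk: "m - k = Suc i" using Suc.prems by (simp add: i_def)
  define e where "e = \<nu> + of_nat (Suc k)"
  have e: "Re e > 0" "e - 1 = \<nu> + of_nat k" using nu by (simp_all add: e_def)
  obtain K' where K': "\<And>x. x \<in> S \<Longrightarrow> (K has_vector_derivative K' x) (at x within S)" "smooth_on S K'"
    using smooth_on_obtain_deriv[OF ab K(1)] by blast
  \<comment> \<open>Obtained by inserting \<open>q = G ^ Suc i * K\<close> into
    \<open>q' - e * G' * q / G\<close> and taking out \<open>G' * G ^ i\<close>.\<close>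
  define L where "L = (\<lambda>x. (of_nat (Suc i) - e) * K x + G x * K' x / G' x)"
  define q where "q = (\<lambda>x. G x ^ Suc i * K x)"
  define q' where "q' = (\<lambda>x. G x ^ Suc i * K' x + of_nat (Suc i) * G x ^ i * G' x * K x)"
  have G'_nz: "G' x \<noteq> 0" if "x \<in> S" for x using g'_nz[OF that] by simp
  have L_smooth: "smooth_on S L"
    unfolding L_def
    by (intro smooth_on_add smooth_on_mult smooth_on_divide smooth_on_const K(1) K'(2) smooth_G smooth_G' G'_nz)
  have dpow: "((\<lambda>x. G x ^ Suc n) has_vector_derivative of_nat (Suc n) * G x ^ n * G' x) (at x within S)"
    if "x \<in> S" for x n
  proof (induction n)
    case 0
    then show ?case using deriv_G[OF that] by (simp del: nderiv.simps)
  next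
    case (Suc n)
    from has_vector_derivative_mult[OF deriv_G[OF that] Suc] show ?case
      by (simp add: algebra_simps del: nderiv.simps)
  qed
  have q: "(q has_vector_derivative q' x) (at x within S)" if "x \<in> S" for x
    unfolding q_def q'_def by (intro has_vector_derivative_mult dpow K' that)
  have q_L: "q' x - e * G' x * q x / G x = G' x * G x ^ i * L x" if "x \<in> S" "x \<noteq> \<xi>" for x
    using G'_nz[OF that(1)] g_nz[OF that] unfolding q_def q'_def L_def
    by (simp add: field_simps del: nderiv.simps of_nat_Suc)
  have cont_GL: "continuous_on S (\<lambda>x. G' x * G x ^ i * L x)"
    by (intro smooth_on_continuous smooth_on_mult smooth_on_power smooth_G smooth_G' L_smooth)
  have sigma: "sigma_t \<nu> g \<xi> S h (Suc k) x = G' x * G x ^ i * L x" if "x \<in> S" for x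
  proof -
    define s where "s = sigma_t \<nu> g \<xi> S h k"
    define F where "F = (\<lambda>y. G y powr e * vector_derivative (\<lambda>t. (s t - s \<xi>) / (G t powr e * G' t)) (at y within S))"
    have s: "s t = G' t * q t" if "t \<in> S" for t
      using K(2)[OF that] by (simp add: s_def q_def mk del: nderiv.simps)
    have "s \<xi> = 0" using s[OF xi] by (simp add: q_def g_xi)
    then have F: "F y = G' y * G y ^ i * L y" if "y \<in> S" "y \<noteq> \<xi>" for y
      unfolding F_def using sigma_integrand_derivative[OF q s] q_L that by simp
    \<comment> \<open>Away from \<open>\<xi>\<close> the function \<open>F\<close> equals this
      continuous one, so the \<open>Lim\<close> in \<open>sigma_t\<close> is its value at
      \<open>\<xi>\<close>.\<close>
    have "((\<lambda>y. G' y * G y ^ i * L y) \<longlongrightarrow> G' \<xi> * G \<xi> ^ i * L \<xi>) (at \<xi> within S)"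
      using cont_GL xi by (simp add: continuous_on_def)
    moreover have "\<forall>\<^sub>F y in at \<xi> within S. G' y * G y ^ i * L y = F y"
      unfolding eventually_at_filter by (rule always_eventually) (metis F)
    ultimately have "(F \<longlongrightarrow> G' \<xi> * G \<xi> ^ i * L \<xi>) (at \<xi> within S)"
      by (rule Lim_transform_eventually)
    moreover have "at \<xi> within S \<noteq> bot"
      using ab xi by (metis islimpt_Icc trivial_limit_within)
    ultimately have "Lim (at \<xi> within S) F = G' \<xi> * G \<xi> ^ i * L \<xi>"
      by (intro tendsto_Lim)
    moreover have "sigma_t \<nu> g \<xi> S h (Suc k) x = (if x = \<xi> then Lim (at \<xi> within S) F else F x)"
      unfolding sigma_t.simps Let_def F_def s_def e_def by simp
    ultimately show ?thesis using F that by auto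
  qed
  have vanish: "vanishes_to i S c L" if c: "c \<in> S" "vanishes_to (Suc i) S c K" for c
  proof -
    have "vanishes_to i S c (\<lambda>x. (of_nat (Suc i) - e) * K x + (G x / G' x) * K' x)"
    proof (intro vanishes_to_add vanishes_to_mult_left C_k_on_const)
      show "vanishes_to i S c K" using vanishes_to_SucD c by blast
      show "vanishes_to i S c K'" by (rule vanishes_to_deriv[OF ab c K'(1)])
      show "C_k_on i S (\<lambda>x. G x / G' x)"
        using smooth_on_divide[OF smooth_G smooth_G' G'_nz] unfolding smooth_on_def by blast
    qed
    then show ?thesis unfolding L_def by simp
  qed
  \<comment> \<open>Both boundary terms disappear, for different reasons: at an end other than
    \<open>\<xi>\<close> the factor \<open>K\<close> is 0, at an end equal to \<open>\<xi>\<close>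
    the power of \<open>G\<close> is.\<close>
  have "vanishes_to (Suc i) S a K \<or> a = \<xi>" "vanishes_to (Suc i) S b K \<or> b = \<xi>"
    using K(3,4) mk by auto
  then have q0: "q a = 0" "q b = 0" by (auto simp: q_def g_xi)
  have step: "((\<lambda>x. G' x * q x * J (\<nu> + of_nat k) \<omega> x) has_integral
      - integral S (\<lambda>x. G' x * G x ^ i * L x * J e \<omega> x) / of_real \<omega>) S" if "\<omega> > 0" for \<omega>
  proof -
    have cont: "continuous_on S (\<lambda>x. G' x * G x ^ i * L x * J e \<omega> x)"
      by (intro continuous_on_mult[OF cont_GL] continuous_J e)
    have "G' x * G x ^ i * L x * J e \<omega> x = (q' x - e * G' x * q x / G x) * J e \<omega> x"
      if "x \<in> S" "x \<noteq> \<xi>" for x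
      unfolding q_L[OF that] ..
    moreover have "\<omega> \<noteq> 0" using that by simp
    ultimately show ?thesis
      using integration_by_parts[OF e(1) _ q cont] unfolding q0 e(2) by simp
  qed
  have main: "(\<lambda>x. of_real (h x) * J \<nu> \<omega> x) integrable_on S \<and>
       integral S (\<lambda>x. of_real (h x) * J \<nu> \<omega> x) =
       (- 1 / of_real \<omega>) ^ Suc k * integral S (\<lambda>x. G' x * G x ^ i * L x * J e \<omega> x)"
    if \<omega>: "\<omega> > 0" for \<omega>
  proof
    have eq: "(\<lambda>x. G' x * q x * J (\<nu> + of_nat k) \<omega> x) = (\<lambda>x. G' x * G x ^ (m - k) * K x * J (\<nu> + of_nat k) \<omega> x)"
      by (simp add: q_def mk mult.assoc del: nderiv.simps)
    show "(\<lambda>x. of_real (h x) * J \<nu> \<omega> x) integrable_on S"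
    \<comment> \<open>The claim concerns the original integrand in every step, so it is proved in
      the first one and inherited afterwards.\<close>
    proof (cases "k = 0")
      case True
      have "sigma_t \<nu> g \<xi> S h k x = G' x * q x" if "x \<in> S" for x
        using K(2)[OF that] by (simp add: q_def mk mult.assoc del: nderiv.simps sigma_t.simps power_Suc)
      then have hq: "of_real (h x) = G' x * q x" if "x \<in> S" for x
        using that unfolding True sigma_t.simps by blast
      have "(\<lambda>x. of_real (h x) * J \<nu> \<omega> x) integrable_on S \<longleftrightarrow> (\<lambda>x. G' x * q x * J \<nu> \<omega> x) integrable_on S"
        by (intro integrable_cong) (simp only: hq)
      moreover have "(\<lambda>x. G' x * q x * J \<nu> \<omega> x) integrable_on S"
        using has_integral_integrable[OF step[OF \<omega>]] True by (simp only: of_nat_0 add_0_right)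
      ultimately show ?thesis by blast
    qed (use int_K(1)[OF \<omega>] in simp)
    show "integral S (\<lambda>x. of_real (h x) * J \<nu> \<omega> x) =
       (- 1 / of_real \<omega>) ^ Suc k * integral S (\<lambda>x. G' x * G x ^ i * L x * J e \<omega> x)"
      unfolding int_K(2)[OF \<omega>] eq[symmetric] integral_unique[OF step[OF \<omega>]]
      by (simp add: field_simps del: nderiv.simps)
  qed
  show ?case
  proof (intro exI[of _ L] conjI allI impI ballI)
    show "smooth_on S L" by (rule L_smooth)
    fix x assume "x \<in> S"
    then show "sigma_t \<nu> g \<xi> S h (Suc k) x = G' x * G x ^ (m - Suc k) * L x"
      by (rule sigma[unfolded i_def])
  next
    assume "a \<noteq> \<xi>"
    then show "vanishes_to (m - Suc k) S a L"
      using vanish[of a] K(3) mk ab unfolding i_def[symmetric] by simp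
  next
    assume "b \<noteq> \<xi>"
    then show "vanishes_to (m - Suc k) S b L"
      using vanish[of b] K(4) mk ab unfolding i_def[symmetric] by simp
  next
    fix \<omega> :: real assume \<omega>: "\<omega> > 0"
    show "(\<lambda>x. of_real (h x) * J \<nu> \<omega> x) integrable_on S"
      by (rule conjunct1[OF main[OF \<omega>]])
    show "integral S (\<lambda>x. of_real (h x) * J \<nu> \<omega> x) = (- 1 / of_real \<omega>) ^ Suc k *
        integral S (\<lambda>x. G' x * G x ^ (m - Suc k) * L x * J (\<nu> + of_nat (Suc k)) \<omega> x)"
      by (rule conjunct2[OF main[OF \<omega>], unfolded e_def i_def])
  qed
qed

text \<open>Allows powers of \<open>x - \<xi>\<close> to be exchanged for powers of
  \<open>g\<close>. Away from \<open>\<xi>\<close> the cofactor is nonzero with \<open>g\<close>; at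
  \<open>\<xi>\<close>, differentiating the factorisation shows that it equals
  \<open>g' \<xi>\<close>.\<close>

lemma phase_linear_factor:
  "\<exists>D. smooth_on S D \<and> (\<forall>x\<in>S. g x = (x - \<xi>) * D x) \<and> (\<forall>x\<in>S. D x \<noteq> 0)"
proof -
  have "vanishes_to 1 S \<xi> g"
    unfolding One_nat_def vanishes_to.simps using deriv_g g_xi by blast
  from vanishes_to_factor[OF ab xi smooth_g this] obtain D
    where D: "smooth_on S D" "\<And>x. x \<in> S \<Longrightarrow> g x = (x - \<xi>) * D x" by auto
  obtain D' where D': "\<And>x. x \<in> S \<Longrightarrow> (D has_vector_derivative D' x) (at x within S)"
    using smooth_on_obtain_deriv[OF ab D(1)] by blast
  have "((\<lambda>x. x - \<xi>) has_vector_derivative 1) (at \<xi> within S)"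
    by (auto intro!: derivative_eq_intros)
  from has_vector_derivative_mult[OF this D'[OF xi]]
  have "((\<lambda>x. (x - \<xi>) * D x) has_vector_derivative D \<xi>) (at \<xi> within S)" by simp
  then have "(g has_vector_derivative D \<xi>) (at \<xi> within S)"
    by (rule has_vector_derivative_transform[OF xi, rotated]) (rule D(2))
  then have "D \<xi> = g' \<xi>"
    by (rule has_vector_derivative_Icc_unique[OF ab xi _ deriv_g[OF xi]])
  then have "D x \<noteq> 0" if "x \<in> S" for x
    using D(2)[OF that] g_nz[OF that] g'_nz[OF xi] by (cases "x = \<xi>") auto
  with D show ?thesis by blast
qed

text \<open>The constant is the minimum of \<open>\<bar>D\<bar>\<close> over the interval, positive
  by compactness. It reduces decay in \<open>g\<close> to decay in the distance from
  \<open>\<xi>\<close>.\<close>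

lemma phase_lower_bound: "\<exists>c>0. \<forall>x\<in>S. c * \<bar>x - \<xi>\<bar> \<le> \<bar>g x\<bar>"
proof -
  obtain D where D: "smooth_on S D" "\<And>x. x \<in> S \<Longrightarrow> g x = (x - \<xi>) * D x" "\<And>x. x \<in> S \<Longrightarrow> D x \<noteq> 0"
    using phase_linear_factor by meson
  have "\<exists>z\<in>S. \<forall>x\<in>S. \<bar>D z\<bar> \<le> \<bar>D x\<bar>"
    by (rule continuous_attains_inf) (use ab smooth_on_continuous[OF D(1)] in \<open>auto intro: continuous_intros\<close>)
  then obtain z where z: "z \<in> S" "\<And>x. x \<in> S \<Longrightarrow> \<bar>D z\<bar> \<le> \<bar>D x\<bar>" by blast
  show ?thesis
  proof (intro exI[of _ "\<bar>D z\<bar>"] conjI ballI)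
    fix x assume "x \<in> S"
    then show "\<bar>D z\<bar> * \<bar>x - \<xi>\<bar> \<le> \<bar>g x\<bar>"
      using mult_right_mono[OF z(2), of x "\<bar>x - \<xi>\<bar>"] D(2) by (simp add: abs_mult mult.commute)
  qed (use D(3)[OF z(1)] in simp)
qed

lemma smooth_divide_power:
  fixes h :: "real \<Rightarrow> complex"
  assumes "smooth_on S h" "vanishes_to m S \<xi> h"
  shows "\<exists>K. smooth_on S K \<and> (\<forall>x\<in>S. h x = G x ^ m * K x)"
proof -
  obtain D where D: "smooth_on S D" "\<And>x. x \<in> S \<Longrightarrow> g x = (x - \<xi>) * D x" "\<And>x. x \<in> S \<Longrightarrow> D x \<noteq> 0"
    using phase_linear_factor by meson
  obtain K where K: "smooth_on S K" "\<And>x. x \<in> S \<Longrightarrow> h x = of_real (x - \<xi>) ^ m * K x"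
    using vanishes_to_factor[OF ab xi assms] by blast
  show ?thesis
  proof (intro exI conjI ballI)
    show "smooth_on S (\<lambda>x. K x / complex_of_real (D x) ^ m)"
      by (intro smooth_on_divide smooth_on_power smooth_on_of_real K(1) D(1)) (use D(3) in simp)
    fix x assume "x \<in> S"
    then show "h x = G x ^ m * (K x / complex_of_real (D x) ^ m)"
      using K(2) D(2,3) by (simp add: power_mult_distrib)
  qed
qed

section \<open>Order in \<open>\<omega>\<close> of the integral that remains after the chain\<close>

lemma norm_bound_on_S:
  assumes "continuous_on S (f :: real \<Rightarrow> complex)"
  shows "\<exists>M\<ge>0. \<forall>x\<in>S. norm (f x) \<le> M"
proof -
  have "bounded (f ` S)" by (intro compact_imp_bounded compact_continuous_image assms) simp
  then obtain M where "\<forall>x\<in>S. norm (f x) \<le> M" unfolding bounded_iff by auto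
  then show ?thesis by (intro exI[of _ "max M 0"]) (auto simp: le_max_iff_disj)
qed

text \<open>One integration by parts leaves a factor \<open>1 / \<omega>\<close>, so everything else
  must stay bounded. The critical term contains \<open>K / G\<close>. As \<open>\<omega>\<close>
  times \<open>J e\<close> divided by its argument, it is at most a constant times \<open>\<omega> *
  (1 + \<omega> * c * \<bar>x - \<xi>\<bar>) powr (-3/2)\<close>, whose integral is bounded
  uniformly in \<open>\<omega>\<close>.\<close>

lemma integral_bound:
  assumes \<mu>: "Re \<mu> > 0" and K: "smooth_on S K"
  shows "\<exists>C. \<forall>\<omega>>0. norm (integral S (\<lambda>x. G' x * K x * J \<mu> \<omega> x)) \<le> C * \<omega> powr (-1)"
proof -
  define e where "e = \<mu> + 1"
  have e: "Re e > 1" "Re e > 0" "e - 1 = \<mu>" using \<mu> by (simp_all add: e_def)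
  obtain K' where K': "\<And>x. x \<in> S \<Longrightarrow> (K has_vector_derivative K' x) (at x within S)" "smooth_on S K'"
    using smooth_on_obtain_deriv[OF ab K] by blast
  obtain C1 where C1: "C1 \<ge> 0" "\<And>t. norm (BesselJ e (of_real t)) \<le> C1"
    using BesselJ_bounds[OF e(2)] by meson
  obtain C2 where C2: "C2 \<ge> 0"
    "\<And>t. norm (BesselJ e (of_real t) / of_real t) \<le> C2 / ((1 + \<bar>t\<bar>) * sqrt (1 + \<bar>t\<bar>))"
    using BesselJ_div_bound[OF e(1)] by meson
  obtain c where c: "c > 0" "\<And>x. x \<in> S \<Longrightarrow> c * \<bar>x - \<xi>\<bar> \<le> \<bar>g x\<bar>"
    using phase_lower_bound by meson
  obtain M1 where M1: "M1 \<ge> 0" "\<And>x. x \<in> S \<Longrightarrow> norm (K' x) \<le> M1"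
    using norm_bound_on_S[OF smooth_on_continuous[OF K'(2)]] by meson
  have cont: "continuous_on S (\<lambda>x. e * G' x * K x)"
    by (intro smooth_on_continuous smooth_on_mult smooth_on_const smooth_G' K)
  obtain M2 where M2: "M2 \<ge> 0" "\<And>x. x \<in> S \<Longrightarrow> norm (e * G' x * K x) \<le> M2"
    using norm_bound_on_S[OF cont] by meson
  define C where "C = norm (K b) * C1 + norm (K a) * C1 + (M1 * C1 * (b - a) + M2 * C2 * (4 / c))"
  have "norm (integral S (\<lambda>x. G' x * K x * J \<mu> \<omega> x)) \<le> C * \<omega> powr (-1)" if \<omega>: "\<omega> > 0" for \<omega>
  proof -
    define R where "R = (\<lambda>x. BesselJ e (of_real (\<omega> * g x)) / of_real (\<omega> * g x))"
    define B where "B = (\<lambda>x. K' x * J e \<omega> x - of_real \<omega> * ((e * G' x * K x) * R x))"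
    have "continuous_on S R"
      unfolding R_def
      by (rule continuous_on_compose2[OF continuous_on_BesselJ_div[OF e(1), of UNIV], of S "\<lambda>x. \<omega> * g x"])
         (auto intro!: continuous_intros smooth_on_continuous[OF smooth_g])
    then have B_cont: "continuous_on S B"
      unfolding B_def
      by (intro continuous_on_diff continuous_on_mult continuous_on_const cont continuous_J e smooth_on_continuous[OF K'(2)])
    have B_eq: "B x = (K' x - e * G' x * K x / G x) * J e \<omega> x" if "x \<in> S" "x \<noteq> \<xi>" for x
      using g_nz[OF that] \<omega> unfolding B_def R_def by (simp add: field_simps del: nderiv.simps)
    define \<phi> where "\<phi> = (\<lambda>x. 1 / ((1 + (\<omega> * c) * \<bar>x - \<xi>\<bar>) * sqrt (1 + (\<omega> * c) * \<bar>x - \<xi>\<bar>)))"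
    have \<phi>: "\<phi> integrable_on S" "integral S \<phi> \<le> 4 / (\<omega> * c)"
      using integral_decay_le[of a \<xi> b "\<omega> * c"] xi \<omega> c(1) unfolding \<phi>_def by auto
    have R_le: "norm (R x) \<le> C2 * \<phi> x" if "x \<in> S" for x
    proof -
      have *: "\<omega> * c * \<bar>x - \<xi>\<bar> \<le> \<bar>\<omega> * g x\<bar>"
        using c(2)[OF that] \<omega> by (simp add: abs_mult)
      have "0 \<le> \<omega> * c * \<bar>x - \<xi>\<bar>" using \<omega> c(1) by simp
      then have "C2 / ((1 + \<bar>\<omega> * g x\<bar>) * sqrt (1 + \<bar>\<omega> * g x\<bar>)) \<le> C2 * \<phi> x"
        unfolding \<phi>_def times_divide_eq_right mult_1_right using C2(1) *
        by (intro divide_left_mono mult_mono mult_pos_pos) auto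
      then show ?thesis using C2(2)[of "\<omega> * g x"] unfolding R_def by linarith
    qed
    have "norm (integral S B) \<le> integral S (\<lambda>x. M1 * C1 + \<omega> * (M2 * C2) * \<phi> x)"
    proof (rule integral_norm_bound_integral)
      show "B integrable_on S" by (rule integrable_continuous_real[OF B_cont])
      show "(\<lambda>x. M1 * C1 + \<omega> * (M2 * C2) * \<phi> x) integrable_on S"
        by (intro integrable_add integrable_on_mult_right \<phi>) auto
      fix x assume x: "x \<in> S"
      have "norm (K' x * J e \<omega> x) \<le> M1 * C1"
        unfolding norm_mult using M1 C1 x by (intro mult_mono) (auto simp del: of_real_mult)
      moreover have "norm ((e * G' x * K x) * R x) \<le> M2 * (C2 * \<phi> x)"
        unfolding norm_mult[of _ "R x"] using M2 R_le x by (intro mult_mono) auto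
      then have "norm (of_real \<omega> * ((e * G' x * K x) * R x)) \<le> \<omega> * (M2 * (C2 * \<phi> x))"
        using \<omega> by (simp only: norm_mult[of "of_real \<omega>"] norm_of_real abs_of_pos mult_le_cancel_left_pos)
      ultimately show "norm (B x) \<le> M1 * C1 + \<omega> * (M2 * C2) * \<phi> x"
        unfolding B_def by (intro order_trans[OF norm_triangle_ineq4]) (simp add: mult.assoc del: nderiv.simps)
    qed
    also have "\<dots> = M1 * C1 * (b - a) + \<omega> * (M2 * C2) * integral S \<phi>"
      using ab \<phi> by (subst integral_add) (auto intro!: integrable_on_mult_right)
    also have "\<dots> \<le> M1 * C1 * (b - a) + \<omega> * (M2 * C2) * (4 / (\<omega> * c))"
      using \<omega> M2 C2 \<phi> by (intro add_left_mono mult_left_mono) auto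
    also have "\<dots> = M1 * C1 * (b - a) + M2 * C2 * (4 / c)"
      using \<omega> c(1) by (simp add: field_simps)
    finally have intB: "norm (integral S B) \<le> M1 * C1 * (b - a) + M2 * C2 * (4 / c)" .
    have bd: "norm (K x * J e \<omega> x) \<le> norm (K x) * C1" for x
      unfolding norm_mult by (intro mult_left_mono C1) simp
    have "integral S (\<lambda>x. G' x * K x * J \<mu> \<omega> x) = (K b * J e \<omega> b - K a * J e \<omega> a - integral S B) / of_real \<omega>"
      using integral_unique[OF integration_by_parts[OF e(2) _ K'(1) B_cont B_eq]] \<omega> by (simp only: e(3)) simp
    then have "norm (integral S (\<lambda>x. G' x * K x * J \<mu> \<omega> x)) = norm (K b * J e \<omega> b - K a * J e \<omega> a - integral S B) / \<omega>"
      using \<omega> by (simp add: norm_divide)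
    also have "\<dots> \<le> C / \<omega>"
      unfolding C_def using \<omega>
      by (intro divide_right_mono order_trans[OF norm_triangle_ineq4] add_mono intB bd) auto
    finally show ?thesis using \<omega> by (simp add: powr_minus divide_inverse)
  qed
  then show ?thesis by blast
qed

text \<open>Since \<open>K = G * L\<close>, the quotient \<open>K / G\<close> is smooth. Every term
  left by the integration by parts is then a bounded function times \<open>J e\<close>, which is at
  most a constant over \<open>sqrt \<bar>\<omega> * g x\<bar>\<close>; the singularity
  \<open>1 / sqrt \<bar>x - \<xi>\<bar>\<close> is integrable.\<close>

lemma integral_bound_vanishing:
  assumes \<mu>: "Re \<mu> > 0" and K: "smooth_on S K" "K \<xi> = 0"
  shows "\<exists>C. \<forall>\<omega>>0. norm (integral S (\<lambda>x. G' x * K x * J \<mu> \<omega> x)) \<le> C * \<omega> powr (-3/2)"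
proof -
  define e where "e = \<mu> + 1"
  have e: "Re e > 1" "Re e > 0" "e - 1 = \<mu>" using \<mu> by (simp_all add: e_def)
  obtain K' where K': "\<And>x. x \<in> S \<Longrightarrow> (K has_vector_derivative K' x) (at x within S)" "smooth_on S K'"
    using smooth_on_obtain_deriv[OF ab K(1)] by blast
  have "vanishes_to 1 S \<xi> K"
    unfolding One_nat_def vanishes_to.simps using K(2) K'(1) by blast
  from smooth_divide_power[OF K(1) this]
  obtain L where L: "smooth_on S L" "\<And>x. x \<in> S \<Longrightarrow> K x = G x * L x"
    unfolding power_one_right by meson
  obtain C1 where C1: "C1 \<ge> 0" "\<And>t. norm (BesselJ e (of_real t)) * sqrt \<bar>t\<bar> \<le> C1"
    using BesselJ_bounds[OF e(2)] by meson
  \<comment> \<open>At a zero of the argument both sides are 0, the right one by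
    \<open>x / 0 = 0\<close>. This covers the boundary term at an end equal to
    \<open>\<xi>\<close>.\<close>
  have J_le: "norm (J e \<omega> x) \<le> C1 / sqrt \<bar>\<omega> * g x\<bar>" for \<omega> x
  proof (cases "\<omega> * g x = 0")
    case True
    have "e \<noteq> 0" using e by auto
    then show ?thesis unfolding True by (simp add: BesselJ_zero)
  next
    case False
    then show ?thesis using C1(2)[of "\<omega> * g x"] by (simp add: pos_le_divide_eq)
  qed
  obtain c where c: "c > 0" "\<And>x. x \<in> S \<Longrightarrow> c * \<bar>x - \<xi>\<bar> \<le> \<bar>g x\<bar>"
    using phase_lower_bound by meson
  define A where "A = (\<lambda>x. K' x - e * G' x * L x)"
  have A_cont: "continuous_on S A"
    unfolding A_def
    by (intro smooth_on_continuous smooth_on_diff smooth_on_mult smooth_on_const smooth_G' K' L)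
  obtain M where M: "M \<ge> 0" "\<And>x. x \<in> S \<Longrightarrow> norm (A x) \<le> M"
    using norm_bound_on_S[OF A_cont] by meson
  define I where "I = 2 * sqrt (\<xi> - a) + 2 * sqrt (b - \<xi>)"
  have I: "((\<lambda>x. 1 / sqrt \<bar>x - \<xi>\<bar>) has_integral I) S"
    unfolding I_def using xi by (intro has_integral_inverse_sqrt_dist) auto
  define C where "C = norm (K b) * (C1 / sqrt \<bar>g b\<bar>) + norm (K a) * (C1 / sqrt \<bar>g a\<bar>) + M * C1 / sqrt c * I"
  have "norm (integral S (\<lambda>x. G' x * K x * J \<mu> \<omega> x)) \<le> C * \<omega> powr (-3/2)" if \<omega>: "\<omega> > 0" for \<omega>
  proof -
    define B where "B = (\<lambda>x. A x * J e \<omega> x)"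
    have B_cont: "continuous_on S B"
      unfolding B_def by (intro continuous_on_mult A_cont continuous_J e)
    have B_eq: "B x = (K' x - e * G' x * K x / G x) * J e \<omega> x" if "x \<in> S" "x \<noteq> \<xi>" for x
      using g_nz[OF that] L(2)[OF that(1)] unfolding B_def A_def by (simp add: field_simps del: nderiv.simps)
    have "norm (integral S B) \<le> integral S (\<lambda>x. M * C1 / (sqrt \<omega> * sqrt c) * (1 / sqrt \<bar>x - \<xi>\<bar>))"
    proof (rule integral_norm_bound_integral)
      show "B integrable_on S" by (rule integrable_continuous_real[OF B_cont])
      show "(\<lambda>x. M * C1 / (sqrt \<omega> * sqrt c) * (1 / sqrt \<bar>x - \<xi>\<bar>)) integrable_on S"
        using I by (intro integrable_on_mult_right) blast
      fix x assume x: "x \<in> S"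
      have "norm (J e \<omega> x) \<le> C1 / (sqrt \<omega> * sqrt c * sqrt \<bar>x - \<xi>\<bar>)"
      proof (cases "x = \<xi>")
        case True
        then show ?thesis using J_le[of \<omega> \<xi>] by (simp add: g_xi)
      next
        case False
        have "sqrt \<omega> * sqrt c * sqrt \<bar>x - \<xi>\<bar> = sqrt (\<omega> * (c * \<bar>x - \<xi>\<bar>))"
          by (simp add: real_sqrt_mult)
        also have "\<dots> \<le> sqrt \<bar>\<omega> * g x\<bar>"
          using c(2)[OF x] \<omega> by (simp add: abs_mult)
        finally have "C1 / sqrt \<bar>\<omega> * g x\<bar> \<le> C1 / (sqrt \<omega> * sqrt c * sqrt \<bar>x - \<xi>\<bar>)"
          using C1(1) \<omega> c(1) False g_nz[OF x False] by (intro divide_left_mono mult_pos_pos) auto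
        then show ?thesis using J_le[of \<omega> x] by linarith
      qed
      then have "norm (B x) \<le> M * (C1 / (sqrt \<omega> * sqrt c * sqrt \<bar>x - \<xi>\<bar>))"
        unfolding B_def norm_mult using M x by (intro mult_mono) auto
      then show "norm (B x) \<le> M * C1 / (sqrt \<omega> * sqrt c) * (1 / sqrt \<bar>x - \<xi>\<bar>)" by simp
    qed
    also have "\<dots> = M * C1 / (sqrt \<omega> * sqrt c) * I"
      using integral_unique[OF I] by (simp only: integral_mult_right)
    finally have intB: "norm (integral S B) \<le> M * C1 / sqrt c * I / sqrt \<omega>"
      by (simp add: mult.commute)
    have bd: "norm (K x * J e \<omega> x) \<le> norm (K x) * (C1 / sqrt \<bar>g x\<bar>) / sqrt \<omega>" for x
    proof -
      have "norm (K x) * norm (J e \<omega> x) \<le> norm (K x) * (C1 / sqrt \<bar>\<omega> * g x\<bar>)"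
        by (intro mult_left_mono J_le) simp
      then show ?thesis using \<omega> by (simp add: norm_mult abs_mult real_sqrt_mult mult.commute)
    qed
    have "integral S (\<lambda>x. G' x * K x * J \<mu> \<omega> x) = (K b * J e \<omega> b - K a * J e \<omega> a - integral S B) / of_real \<omega>"
      using integral_unique[OF integration_by_parts[OF e(2) _ K'(1) B_cont B_eq]] \<omega> by (simp only: e(3)) simp
    then have "norm (integral S (\<lambda>x. G' x * K x * J \<mu> \<omega> x)) = norm (K b * J e \<omega> b - K a * J e \<omega> a - integral S B) / \<omega>"
      using \<omega> by (simp add: norm_divide)
    also have "\<dots> \<le> (C / sqrt \<omega>) / \<omega>"
      unfolding C_def add_divide_distrib[of _ _ "sqrt \<omega>"] using \<omega>
      by (intro divide_right_mono order_trans[OF norm_triangle_ineq4] add_mono intB bd) auto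
    also have "\<dots> = C * \<omega> powr (-3/2)"
    proof -
      have "\<omega> powr (3/2) = \<omega> powr (1/2 + 1)" by simp
      also have "\<dots> = sqrt \<omega> * \<omega>" unfolding powr_add using \<omega> by (simp add: powr_half_sqrt)
      finally have "\<omega> powr (-3/2) = inverse (sqrt \<omega> * \<omega>)"
        using powr_minus[of \<omega> "3/2"] by simp
      then show ?thesis using \<omega> by (simp add: field_simps)
    qed
    finally show ?thesis .
  qed
  then show ?thesis by blast
qed

end

section \<open>From the integral estimates to the interpolation error\<close>

text \<open>If one of the two integrands is not integrable then neither is the other, and both values are
  the junk value \<open>0\<close> of the integral; so no integrability of \<open>f\<close> and \<open>p\<close> themselves is needed.\<close>

lemma norm_BesselH_diff_le:
  assumes "(\<lambda>x. complex_of_real (f x - p x) * BesselJ \<nu> (of_real (\<omega> * g x))) integrable_on {a..b}"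
  shows "norm (BesselH \<nu> g a b f \<omega> - BesselH \<nu> g a b p \<omega>) \<le> norm (BesselH \<nu> g a b (\<lambda>x. f x - p x) \<omega>)"
proof -
  let ?I = "\<lambda>h x. complex_of_real (h x) * BesselJ \<nu> (of_real (\<omega> * g x))"
  have f: "?I f x = ?I p x + ?I (\<lambda>x. f x - p x) x" and p: "?I p x = ?I f x - ?I (\<lambda>x. f x - p x) x" for x
    by (simp_all add: algebra_simps)
  show ?thesis
  proof (cases "?I f integrable_on {a..b}")
    case True
    have "?I p integrable_on {a..b}"
      unfolding p by (rule integrable_diff[OF True assms])
    then have "BesselH \<nu> g a b f \<omega> = BesselH \<nu> g a b p \<omega> + BesselH \<nu> g a b (\<lambda>x. f x - p x) \<omega>"
      unfolding BesselH_def f by (rule integral_add[OF _ assms])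
    then show ?thesis by simp
  next
    case False
    then have "\<not> ?I p integrable_on {a..b}"
      unfolding f using integrable_add[OF _ assms] by blast
    with False show ?thesis
      by (simp add: BesselH_def not_integrable_integral)
  qed
qed

lemma bigo_powr_at_top:
  fixes F :: "real \<Rightarrow> complex"
  assumes "\<And>\<omega>. \<omega> > 0 \<Longrightarrow> norm (F \<omega>) \<le> C * \<omega> powr e"
  shows "F \<in> O[at_top](\<lambda>\<omega>. complex_of_real (\<omega> powr e))"
proof (rule bigoI)
  show "\<forall>\<^sub>F \<omega> in at_top. norm (F \<omega>) \<le> C * norm (complex_of_real (\<omega> powr e))"
    using eventually_gt_at_top[of 0] by eventually_elim (simp add: assms)
qed

theorem theorem2p10:
  fixes \<nu> :: complex and a b \<xi> :: real and f g :: "real \<Rightarrow> real"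
    and d l n m :: nat and x :: "nat \<Rightarrow> real" and mult :: "nat \<Rightarrow> nat"
    and c :: "nat \<Rightarrow> real" and p :: "real \<Rightarrow> real"
  assumes nu: "Re \<nu> > -1"
    and ab: "a < b"
    and f_smooth: "C_infinity_on {a..b} f"
    and g_smooth: "C_infinity_on {a..b} g"
    and g'_nz: "\<forall>y\<in>{a..b}. nderiv {a..b} 1 g y \<noteq> 0"
    and xi: "\<xi> \<in> {a..b}" "g \<xi> = 0"
    and g_nz: "\<forall>y\<in>{a..b} - {\<xi>}. g y \<noteq> 0"
    and nodes: "x 0 = a" "x d = b" "\<forall>i<d. x i < x (Suc i)"
    and ell: "l \<le> d" "x l = \<xi>"
    and mult_pos: "\<forall>k\<le>d. mult k \<ge> 1"
    and n_def: "n = (\<Sum>k\<le>d. mult k)"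
    and p_def: "p = (\<lambda>y. \<Sum>k<n. c k * phi g {a..b} k y)"
    and interp: "\<forall>k\<le>d. \<forall>j<mult k. nderiv {a..b} j p (x k) = nderiv {a..b} j f (x k)"
    and m: "m \<ge> 1" "mult 0 \<ge> m" "mult l \<ge> m" "mult d \<ge> m"
  shows "(sigma_t \<nu> g \<xi> {a..b} (\<lambda>y. f y - p y) m \<xi> \<noteq> 0 \<longrightarrow>
           (\<lambda>\<omega>. BesselH \<nu> g a b f \<omega> - BesselH \<nu> g a b p \<omega>)
             \<in> O[at_top](\<lambda>\<omega>. complex_of_real (\<omega> powr (- real m - 1))))
       \<and> (sigma_t \<nu> g \<xi> {a..b} (\<lambda>y. f y - p y) m \<xi> = 0 \<longrightarrow>
           (\<lambda>\<omega>. BesselH \<nu> g a b f \<omega> - BesselH \<nu> g a b p \<omega>)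
             \<in> O[at_top](\<lambda>\<omega>. complex_of_real (\<omega> powr (- real m - 3/2))))"
proof -
  interpret bessel_phase a b \<xi> g
    by unfold_locales (use ab xi g_smooth g'_nz g_nz in blast)+
  have p_smooth: "smooth_on S p"
    unfolding p_def phi_def
    by (intro smooth_on_sum smooth_on_mult smooth_on_const smooth_on_power smooth_g smooth_g')
  have p_C: "C_infinity_on S p" by (rule smooth_on_imp_C_infinity_on[OF ab p_smooth])
  define h where "h = (\<lambda>y. f y - p y)"
  define H where "H = (\<lambda>y. complex_of_real (h y))"
  have f_smooth': "smooth_on S f" using C_infinity_on_imp_smooth_on[OF f_smooth, of 0] by simp
  have H_smooth: "smooth_on S H"
    unfolding H_def h_def by (intro smooth_on_of_real smooth_on_diff f_smooth' p_smooth)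
  have vanish: "vanishes_to m S (x k) H" if "k \<le> d" "mult k \<ge> m" for k
  proof -
    have "nderiv S (0 + j) f (x k) = nderiv S (0 + j) p (x k)" if "j < m" for j
      using interp \<open>k \<le> d\<close> \<open>mult k \<ge> m\<close> that by simp
    from vanishes_to_diff_of_nderiv_eq[OF f_smooth p_C this] show ?thesis
      by (simp add: H_def h_def)
  qed
  obtain K1 where K1: "smooth_on S K1" "\<And>y. y \<in> S \<Longrightarrow> H y = G y ^ m * K1 y"
    using smooth_divide_power[OF H_smooth] vanish[OF ell(1) m(3)] unfolding ell(2) by meson
  \<comment> \<open>The factor \<open>G'\<close> is split off too, because it is the one that the
    derivative of \<open>J e \<omega>\<close> supplies in each step of the chain.\<close>
  define K0 where "K0 = (\<lambda>y. K1 y / G' y)"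
  have G'_nz: "G' y \<noteq> 0" if "y \<in> S" for y using g'_nz that by simp
  have K0_smooth: "smooth_on S K0"
    unfolding K0_def by (intro smooth_on_divide K1 smooth_G' G'_nz)
  have H_K0: "complex_of_real (h y) = G' y * G y ^ m * K0 y" if "y \<in> S" for y
    using K1(2)[OF that] G'_nz[OF that] unfolding K0_def H_def by (simp del: nderiv.simps)
  \<comment> \<open>Away from \<open>\<xi>\<close> the factor \<open>G' * G ^ m\<close> is nonzero,
    so the zero of \<open>H\<close> at an end of the interval must come from
    \<open>K0\<close>.\<close>
  have K0_vanish: "vanishes_to m S y K0" if y: "y \<in> S" "y \<noteq> \<xi>" "vanishes_to m S y H" for y
  proof (rule vanishes_to_cancel_right[OF ab y(1)])
    have smooth: "smooth_on S (\<lambda>y. G' y * G y ^ m)"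
      by (intro smooth_on_mult smooth_on_power smooth_G smooth_G')
    show "C_k_on m S K0" using K0_smooth unfolding smooth_on_def by blast
    show "C_k_on m S (\<lambda>y. G' y * G y ^ m)" using smooth unfolding smooth_on_def by blast
    show "G' y * G y ^ m \<noteq> 0" using G'_nz[OF y(1)] g_nz y by simp
    have eq: "H z = K0 z * (G' z * G z ^ m)" if "z \<in> S" for z
      using H_K0[OF that] unfolding H_def by (simp only: mult_ac)
    show "vanishes_to m S y (\<lambda>z. K0 z * (G' z * G z ^ m))"
      by (rule iffD1[OF vanishes_to_cong[OF eq y(1)] y(3)])
  qed
  have van: "a \<noteq> \<xi> \<longrightarrow> vanishes_to m S a K0" "b \<noteq> \<xi> \<longrightarrow> vanishes_to m S b K0"
    using K0_vanish[of a] K0_vanish[of b] vanish[of 0] vanish[of d] nodes(1,2) m ab by simp_all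
  have "\<forall>y\<in>S. complex_of_real (h y) = G' y * G y ^ m * K0 y" using H_K0 by (rule ballI)
  from sigma_chain[OF nu K0_smooth this van order_refl] obtain K where K: "smooth_on S K"
    "\<forall>y\<in>S. sigma_t \<nu> g \<xi> S h m y = G' y * G y ^ (m - m) * K y"
    "\<forall>\<omega>>0. (m > 0 \<longrightarrow> (\<lambda>y. of_real (h y) * J \<nu> \<omega> y) integrable_on S) \<and>
       integral S (\<lambda>y. of_real (h y) * J \<nu> \<omega> y) =
       (- 1 / of_real \<omega>) ^ m * integral S (\<lambda>y. G' y * G y ^ (m - m) * K y * J (\<nu> + of_nat m) \<omega> y)"
    by (elim exE conjE) (rule that; assumption)
  \<comment> \<open>All powers of \<open>G\<close> are used up at \<open>k = m\<close>, so the value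
    at \<open>\<xi>\<close> is \<open>G' \<xi> * K \<xi>\<close>, and the condition on
    \<open>sigma_t\<close> decides whether the last integration by parts meets a pole.\<close>
  have sigma: "sigma_t \<nu> g \<xi> S h m \<xi> = 0 \<longleftrightarrow> K \<xi> = 0"
    using K(2) xi(1) G'_nz[OF xi(1)] by (simp del: nderiv.simps sigma_t.simps)
  have diff: "norm (BesselH \<nu> g a b f \<omega> - BesselH \<nu> g a b p \<omega>)
      \<le> \<omega> powr (- real m) * norm (integral S (\<lambda>y. G' y * K y * J (\<nu> + of_nat m) \<omega> y))" if \<omega>: "\<omega> > 0" for \<omega>
  proof -
    have K3: "(\<lambda>y. of_real (h y) * J \<nu> \<omega> y) integrable_on S"
      "integral S (\<lambda>y. of_real (h y) * J \<nu> \<omega> y) =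
       (- 1 / of_real \<omega>) ^ m * integral S (\<lambda>y. G' y * K y * J (\<nu> + of_nat m) \<omega> y)"
      using mp[OF spec[OF K(3)] \<omega>] m(1) by (simp_all del: nderiv.simps)
    have "norm (BesselH \<nu> g a b f \<omega> - BesselH \<nu> g a b p \<omega>) \<le> norm (BesselH \<nu> g a b h \<omega>)"
      using norm_BesselH_diff_le K3(1) unfolding h_def by blast
    also have "\<dots> = (1 / \<omega>) ^ m * norm (integral S (\<lambda>y. G' y * K y * J (\<nu> + of_nat m) \<omega> y))"
      unfolding BesselH_def K3(2) using \<omega> by (simp only: norm_mult norm_power norm_divide norm_minus_cancel norm_one norm_of_real abs_of_pos)
    also have "(1 / \<omega>) ^ m = \<omega> powr (- real m)"
      using \<omega> by (simp add: powr_minus powr_realpow power_one_over inverse_eq_divide)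
    finally show ?thesis .
  qed
  have bound: "(\<lambda>\<omega>. BesselH \<nu> g a b f \<omega> - BesselH \<nu> g a b p \<omega>) \<in> O[at_top](\<lambda>\<omega>. complex_of_real (\<omega> powr (- real m - e)))"
    if ex: "\<exists>C. \<forall>\<omega>>0. norm (integral S (\<lambda>y. G' y * K y * J (\<nu> + of_nat m) \<omega> y)) \<le> C * \<omega> powr (- e)" for e
  proof -
    obtain C where C: "\<And>\<omega>. \<omega> > 0 \<Longrightarrow> norm (integral S (\<lambda>y. G' y * K y * J (\<nu> + of_nat m) \<omega> y)) \<le> C * \<omega> powr (- e)"
      using ex by meson
    show ?thesis
    proof (rule bigo_powr_at_top)
      fix \<omega> :: real assume \<omega>: "\<omega> > 0"
      have "\<omega> powr (- real m) * norm (integral S (\<lambda>y. G' y * K y * J (\<nu> + of_nat m) \<omega> y))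
          \<le> \<omega> powr (- real m) * (C * \<omega> powr (- e))"
        by (intro mult_left_mono C \<omega>) simp
      also have "\<dots> = C * \<omega> powr (- real m - e)"
        using powr_add[of \<omega> "- real m" "- e"] by simp
      finally show "norm (BesselH \<nu> g a b f \<omega> - BesselH \<nu> g a b p \<omega>) \<le> C * \<omega> powr (- real m - e)"
        using diff[OF \<omega>] by linarith
    qed
  qed
  \<comment> \<open>Already one step of the chain lifts the order out of the range where the Bessel
    function may be singular at 0.\<close>
  have \<mu>: "Re (\<nu> + of_nat m) > 0" using nu m(1) by simp
  show ?thesis
  proof (intro conjI impI)
    show "(\<lambda>\<omega>. BesselH \<nu> g a b f \<omega> - BesselH \<nu> g a b p \<omega>) \<in> O[at_top](\<lambda>\<omega>. complex_of_real (\<omega> powr (- real m - 1)))"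
      by (rule bound[OF integral_bound[OF \<mu> K(1)]])
    assume "sigma_t \<nu> g \<xi> S (\<lambda>y. f y - p y) m \<xi> = 0"
    then have "K \<xi> = 0" using sigma unfolding h_def by blast
    from integral_bound_vanishing[OF \<mu> K(1) this]
    show "(\<lambda>\<omega>. BesselH \<nu> g a b f \<omega> - BesselH \<nu> g a b p \<omega>) \<in> O[at_top](\<lambda>\<omega>. complex_of_real (\<omega> powr (- real m - 3/2)))"
      by (intro bound) (simp only: minus_divide_left)
  qed
qed

end
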